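(* Let $m\ge0$ be an integer, let $\{n_i\}_{i\geq 1}$ be a strictly increasing sequence of natural numbers, and let $\{X_n\}_{n\geq1}$ be a sequence of random variables in a sublinear expectation space $(\Omega,\mathcal{H},\widehat{\mathbb{E}})$ that is blockwise $m$-dependent with respect to $\{n_i\}_{i\geq 1}$. For integers $k\ge 0$ put $$I_k:=\{i\ge 1:\ [2^k,2^{k+1})\cap[n_i,n_{i+1})\neq\emptyset\},\qquad v_k:=\# I_k,$$ and for $n\ge1$ put $\Phi(n):=\max_{0\leq j\leq k}v_j$ if $n\in[2^k,2^{k+1})$, and $S_n:=\sum_{k=1}^n X_k$. Assume: (i) there are a random variable $Z\in\mathcal{H}$ and a constant $C$ such that $\frac{1}{n}\sum_{k=1}^{n}\hat{\mathbb{V}}(|X_k|>t)\leq C\,\hat{\mathbb{V}}(|Z|>t)$ for all integers $n\ge1$ and all $t>0$; (ii) $C_{\hat{\mathbb{V}}}[|Z|^r]<\infty$ for some $r\in[1,2)$. Then $$\hat{\mathbb{V}}^*\left(\limsup_{n\rightarrow\infty}\frac{S_n-\sum_{k=1}^{n}\breve{\mathbb{E}}[X_k]}{n^{1/r}\,\Phi(n)}>0\ \text{ or }\ \liminf_{n\rightarrow\infty}\frac{S_n-\sum_{k=1}^{n}\breve{\mathcal{E}}[X_k]}{n^{1/r}\,\Phi(n)}<0\right)=0.$$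
   Context: Setting. $(\Omega,\mathcal{F})$ is a measurable space and $\mathcal{H}$ is a linear space of real-valued ($\mathcal{F}$-measurable) functions on $\Omega$ such that $X_1,\dots,X_n\in\mathcal{H}$ implies $\varphi(X_1,\dots,X_n)\in\mathcal{H}$ for every $\varphi\in C_{l,Lip}(\mathbb{R}^n)$. Here $C_{l,Lip}(\mathbb{R}^n)$ is the space of functions $\varphi$ with $|\varphi(x)-\varphi(y)|\le C(1+|x|^q+|y|^q)|x-y|$ for all $x,y\in\mathbb{R}^n$, for some $C>0$, $q\in\mathbb{N}$ depending on $\varphi$. $C_{b,Lip}(\mathbb{R}^n)$ is the space of bounded Lipschitz functions. Elements of $\mathcal{H}$ are called random variables. A sublinear expectation is a functional $\widehat{\mathbb{E}}:\mathcal{H}\to\mathbb{R}$ satisfying: (i) $\widehat{\mathbb{E}}[X]\le\widehat{\mathbb{E}}[Y]$ if $X\le Y$; (ii) $\widehat{\mathbb{E}}[c]=c$ for $c\in\mathbb{R}$; (iii) $\widehat{\mathbb{E}}[X+Y]\le\widehat{\mathbb{E}}[X]+\widehat{\mathbb{E}}[Y]$; (iv) $\widehat{\mathbb{E}}[\lambda X]=\lambda\widehat{\mathbb{E}}[X]$ for $\lambda\ge 0$. The triple $(\Omega,\mathcal{H},\widehat{\mathbb{E}})$ is a sublinear expectation space. Truncated expectations. For $c>0$ let $X^{(c)}:=(-c)\vee X\wedge c$. Define $\breve{\mathbb{E}}[X]:=\lim_{c\to\infty}\widehat{\mathbb{E}}[X^{(c)}]$ when the limit exists, and $\breve{\mathcal{E}}[X]:=-\breve{\mathbb{E}}[-X]$.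 (The limit exists whenever $C_{\hat{\mathbb{V}}}[|X|]<\infty$, with $C_{\hat{\mathbb{V}}}$ defined below.) Independence. A random vector $\boldsymbol{Y}\in\mathcal{H}^n$ is independent of a random vector $\boldsymbol{X}\in\mathcal{H}^k$ if $\widehat{\mathbb{E}}[\varphi(\boldsymbol{X},\boldsymbol{Y})]=\widehat{\mathbb{E}}\big[\widehat{\mathbb{E}}[\varphi(\boldsymbol{x},\boldsymbol{Y})]|_{\boldsymbol{x}=\boldsymbol{X}}\big]$ for every $\varphi\in C_{b,Lip}(\mathbb{R}^{k+n})$ (this relation is not symmetric in general). Blockwise $m$-dependence. $\{X_n;n\ge1\}$ is blockwise $m$-dependent with respect to $\{n_i\}$ if for every $i\ge 1$ the block $\{X_n; n_i\le n<n_{i+1}\}$ is $m$-dependent, i.e. either $n_{i+1}-n_i\le m+1$, or $n_{i+1}-n_i>m+1$ and the vector $(X_n; s\le n<n_{i+1})$ is independent of the vector $(X_n; n_i\le n\le r)$ whenever $s-r>m$ (with $n_i\le r<s<n_{i+1}$). Capacities. For $A\in\mathcal{F}$, $\hat{\mathbb{V}}(A):=\inf\{\widehat{\mathbb{E}}[\xi]: I_A\le\xi,\ \xi\in\mathcal{H}\}$ and $\hat{\mathbb{V}}^*(A):=\inf\{\sum_{n=1}^\infty\hat{\mathbb{V}}(A_n): A\subset\bigcup_{n=1}^\infty A_n,\ A_n\in\mathcal{F}\}$. Choquet integral. $C_{\hat{\mathbb{V}}}[X]:=\int_0^\infty\hat{\mathbb{V}}(X\ge t)\,dt+\int_{-\infty}^0[\hat{\mathbb{V}}(X\ge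 t)-1]\,dt$; in particular $C_{\hat{\mathbb{V}}}[|Z|^r]=\int_0^\infty\hat{\mathbb{V}}(|Z|^r\ge t)\,dt$. The quotients in the conclusion are considered for $n$ large enough that $\Phi(n)\ge 1$. *)

theory Defs
  imports "HOL-Analysis.Analysis" "HOL-Library.Discrete_Functions"
begin

section \<open>Test functions on \<open>\<real>\<^sup>n\<close>\<close>

text \<open>
  The dimension varies inside the definitions below, so a vector of \<open>\<real>\<^sup>n\<close> is a function
  \<open>x :: nat \<Rightarrow> real\<close> of which only the coordinates \<open>x 0, \<dots>, x (n - 1)\<close> matter.  The Lipschitz
  conditions are stated with the Euclidean seminorm of these coordinates, and therefore force
  a test function of dimension \<open>n\<close> to depend on the first \<open>n\<close> coordinates only.
\<close>

definition vnorm :: "nat \<Rightarrow> (nat \<Rightarrow> real) \<Rightarrow> real" where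
  "vnorm n x = L2_set x {..<n}"

definition C_l_Lip :: "nat \<Rightarrow> ((nat \<Rightarrow> real) \<Rightarrow> real) set" where
  "C_l_Lip n = {\<phi>. \<exists>C>0. \<exists>q::nat. \<forall>x y.
      \<bar>\<phi> x - \<phi> y\<bar> \<le> C * (1 + vnorm n x ^ q + vnorm n y ^ q) * vnorm n (\<lambda>i. x i - y i)}"

definition C_b_Lip :: "nat \<Rightarrow> ((nat \<Rightarrow> real) \<Rightarrow> real) set" where
  "C_b_Lip n = {\<phi>. (\<exists>B. \<forall>x. \<bar>\<phi> x\<bar> \<le> B) \<and>
      (\<exists>L. \<forall>x y. \<bar>\<phi> x - \<phi> y\<bar> \<le> L * vnorm n (\<lambda>i. x i - y i))}"

text \<open>The vector \<open>(x, y)\<close> of \<open>\<real>\<^bsup>k+n\<^esup>\<close>, where \<open>x\<close> has dimension \<open>k\<close>.\<close>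

definition vappend :: "nat \<Rightarrow> (nat \<Rightarrow> real) \<Rightarrow> (nat \<Rightarrow> real) \<Rightarrow> nat \<Rightarrow> real" where
  "vappend k x y = (\<lambda>i. if i < k then x i else y (i - k))"


section \<open>Sublinear expectation spaces\<close>

text \<open>
  The measurable space is \<open>(space M, sets M)\<close>; the measure carried by \<open>M\<close> is never used.
\<close>

locale sublinear_expectation_space =
  fixes M :: "'a measure" and H :: "('a \<Rightarrow> real) set" and E :: "('a \<Rightarrow> real) \<Rightarrow> real"
  assumes H_measurable: "H \<subseteq> borel_measurable M"
    and H_zero: "(\<lambda>_. 0) \<in> H"
    and H_add: "\<And>X Y. X \<in> H \<Longrightarrow> Y \<in> H \<Longrightarrow> (\<lambda>\<omega>. X \<omega> + Y \<omega>) \<in> H"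
    and H_scale: "\<And>a X. X \<in> H \<Longrightarrow> (\<lambda>\<omega>. a * X \<omega>) \<in> H"
    and H_comp: "\<And>n X \<phi>. 1 \<le> n \<Longrightarrow> (\<And>i. i < n \<Longrightarrow> X i \<in> H) \<Longrightarrow> \<phi> \<in> C_l_Lip n
                  \<Longrightarrow> (\<lambda>\<omega>. \<phi> (\<lambda>i. X i \<omega>)) \<in> H"
    and E_mono: "\<And>X Y. X \<in> H \<Longrightarrow> Y \<in> H \<Longrightarrow> (\<And>\<omega>. \<omega> \<in> space M \<Longrightarrow> X \<omega> \<le> Y \<omega>) \<Longrightarrow> E X \<le> E Y"
    and E_const: "\<And>c. E (\<lambda>_. c) = c"
    and E_subadd: "\<And>X Y. X \<in> H \<Longrightarrow> Y \<in> H \<Longrightarrow> E (\<lambda>\<omega>. X \<omega> + Y \<omega>) \<le> E X + E Y"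
    and E_pos_hom: "\<And>a X. X \<in> H \<Longrightarrow> 0 \<le> a \<Longrightarrow> E (\<lambda>\<omega>. a * X \<omega>) = a * E X"

definition truncate :: "real \<Rightarrow> ('a \<Rightarrow> real) \<Rightarrow> 'a \<Rightarrow> real" where
  "truncate c X = (\<lambda>\<omega>. max (- c) (min (X \<omega>) c))"

text \<open>\<^const>\<open>Lim\<close> is a definite description, so the value is only meaningful if the limit exists.\<close>

definition E_breve :: "(('a \<Rightarrow> real) \<Rightarrow> real) \<Rightarrow> ('a \<Rightarrow> real) \<Rightarrow> real" where
  "E_breve E X = Lim at_top (\<lambda>c. E (truncate c X))"

definition E_breve_lower :: "(('a \<Rightarrow> real) \<Rightarrow> real) \<Rightarrow> ('a \<Rightarrow> real) \<Rightarrow> real" where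
  "E_breve_lower E X = - E_breve E (\<lambda>\<omega>. - X \<omega>)"


section \<open>Independence\<close>

text \<open>The \<open>n\<close>-dimensional vector \<open>Y\<close> is independent of the \<open>k\<close>-dimensional vector \<open>X\<close>.\<close>

definition indep_of ::
  "(('a \<Rightarrow> real) \<Rightarrow> real) \<Rightarrow> nat \<Rightarrow> (nat \<Rightarrow> 'a \<Rightarrow> real) \<Rightarrow> nat \<Rightarrow> (nat \<Rightarrow> 'a \<Rightarrow> real) \<Rightarrow> bool" where
  "indep_of E n Y k X \<longleftrightarrow> (\<forall>\<phi> \<in> C_b_Lip (k + n).
      E (\<lambda>\<omega>. \<phi> (vappend k (\<lambda>i. X i \<omega>) (\<lambda>i. Y i \<omega>)))
      = E (\<lambda>\<omega>. E (\<lambda>\<omega>'. \<phi> (vappend k (\<lambda>i. X i \<omega>) (\<lambda>i. Y i \<omega>')))))"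

text \<open>
  \<open>m\<close>-dependence of the block \<open>{X\<^sub>n; a \<le> n < b}\<close>; the two vectors are
  \<open>(X\<^sub>n; s \<le> n < b)\<close> and \<open>(X\<^sub>n; a \<le> n \<le> r)\<close>.
\<close>

definition m_dependent_block ::
  "(('a \<Rightarrow> real) \<Rightarrow> real) \<Rightarrow> nat \<Rightarrow> (nat \<Rightarrow> 'a \<Rightarrow> real) \<Rightarrow> nat \<Rightarrow> nat \<Rightarrow> bool" where
  "m_dependent_block E m X a b \<longleftrightarrow>
     b - a \<le> m + 1 \<or>
     (b - a > m + 1 \<and>
      (\<forall>r s. a \<le> r \<and> r < s \<and> s < b \<and> s - r > m \<longrightarrow>
         indep_of E (b - s) (\<lambda>i. X (s + i)) (r - a + 1) (\<lambda>i. X (a + i))))"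

definition blockwise_m_dependent ::
  "(('a \<Rightarrow> real) \<Rightarrow> real) \<Rightarrow> nat \<Rightarrow> (nat \<Rightarrow> nat) \<Rightarrow> (nat \<Rightarrow> 'a \<Rightarrow> real) \<Rightarrow> bool" where
  "blockwise_m_dependent E m N X \<longleftrightarrow> (\<forall>i\<ge>1. m_dependent_block E m X (N i) (N (i + 1)))"


section \<open>Capacities and Choquet integral\<close>

definition V_hat :: "'a measure \<Rightarrow> ('a \<Rightarrow> real) set \<Rightarrow> (('a \<Rightarrow> real) \<Rightarrow> real) \<Rightarrow> 'a set \<Rightarrow> real" where
  "V_hat M H E A = Inf {E \<xi> | \<xi>. \<xi> \<in> H \<and> (\<forall>\<omega>\<in>space M. indicator A \<omega> \<le> \<xi> \<omega>)}"

definition V_star :: "'a measure \<Rightarrow> ('a \<Rightarrow> real) set \<Rightarrow> (('a \<Rightarrow> real) \<Rightarrow> real) \<Rightarrow> 'a set \<Rightarrow> ennreal" where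
  "V_star M H E A = Inf {(\<Sum>n. ennreal (V_hat M H E (B n))) | B :: nat \<Rightarrow> 'a set.
      range B \<subseteq> sets M \<and> A \<subseteq> (\<Union>n. B n)}"

text \<open>
  The Choquet integral of \<open>X\<close> with respect to \<open>V_hat\<close> as an extended real.  Since \<open>0 \<le> V_hat \<le> 1\<close>,
  both integrands are nonnegative.  For \<open>X \<ge> 0\<close> the second integral vanishes.
\<close>

definition choquet ::
  "'a measure \<Rightarrow> ('a \<Rightarrow> real) set \<Rightarrow> (('a \<Rightarrow> real) \<Rightarrow> real) \<Rightarrow> ('a \<Rightarrow> real) \<Rightarrow> ereal" where
  "choquet M H E X =
     enn2ereal (\<integral>\<^sup>+ t\<in>{0..}. ennreal (V_hat M H E {\<omega> \<in> space M. X \<omega> \<ge> t}) \<partial>lborel)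
   - enn2ereal (\<integral>\<^sup>+ t\<in>{..0}. ennreal (1 - V_hat M H E {\<omega> \<in> space M. X \<omega> \<ge> t}) \<partial>lborel)"


section \<open>Counting blocks in dyadic intervals\<close>

definition I_blocks :: "(nat \<Rightarrow> nat) \<Rightarrow> nat \<Rightarrow> nat set" where
  "I_blocks N k = {i. 1 \<le> i \<and> {2 ^ k..<2 ^ (k + 1)} \<inter> {N i..<N (i + 1)} \<noteq> {}}"

definition v_blocks :: "(nat \<Rightarrow> nat) \<Rightarrow> nat \<Rightarrow> nat" where
  "v_blocks N k = card (I_blocks N k)"

definition Phi_blocks :: "(nat \<Rightarrow> nat) \<Rightarrow> nat \<Rightarrow> nat" where
  "Phi_blocks N n = (MAX j\<in>{0..floor_log n}. v_blocks N j)"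

lemma Phi_blocks_dyadic:
  assumes "n \<in> {2 ^ k..<2 ^ (k + 1)}"
  shows "Phi_blocks N n = (MAX j\<in>{0..k}. v_blocks N j)"
proof -
  have "n > 0" using assms by (auto intro: Nat.gr0I)
  then have 1: "2 ^ floor_log n \<le> n" and 2: "n < 2 ^ (floor_log n + 1)"
    using floor_log_exp2_le floor_log_exp2_gt by auto
  have "(2::nat) ^ floor_log n < 2 ^ (k + 1)" "(2::nat) ^ k < 2 ^ (floor_log n + 1)"
    using 1 2 assms by (meson atLeastLessThan_iff le_less_trans)+
  then have "floor_log n = k"
    by (simp add: power_strict_increasing_iff del: power_Suc)
  then show ?thesis by (simp add: Phi_blocks_def)
qed

end

theory Submission
  imports Defs
begin

text \<open>
  Put \<open>\<beta> = 2\<^bsup>1/r\<^esup>\<close> and truncate the summands with index in \<open>[2\<^sup>k, 2\<^bsup>k+1\<^esup>)\<close> at level \<open>\<beta>\<^sup>k\<close>.  The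
  Choquet condition only enters through \<open>\<Sum>\<^sub>j 2\<^sup>j V(|Z| > \<beta>\<^sup>j) < \<infinity>\<close>: it makes the truncation
  errors, the variances of the truncated summands (divided by \<open>\<beta>\<^bsup>2k\<^esup>\<close>) and the differences of
  truncated and untruncated expectations summable or negligible.

  A dyadic interval meets \<open>v\<^sub>k\<close> blocks; within a block, the indices of a fixed residue modulo \<open>m + 1\<close>
  form an independent sequence.  For such a sequence, centred so that \<open>E[Y] = 0\<close>, the partial sums
  satisfy a one-sided Kolmogorov inequality: \<open>((s + y)\<^sup>+)\<^sup>2 \<le> (s\<^sup>+)\<^sup>2 + 2 s\<^sup>+ y + y\<^sup>2\<close> and the
  coefficient \<open>2 s\<^sup>+\<close> of \<open>y\<close> is nonnegative, so the cross term has expectation \<open>0\<close>.  If none of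
  the \<open>v\<^sub>k (m + 1)\<close> maxima exceeds \<open>\<epsilon> \<beta>\<^sup>k\<close>, then the sum over the interval is at most
  \<open>\<epsilon> \<beta>\<^sup>k v\<^sub>k (m + 1)\<close>, which is what the normalisation by \<open>\<Phi>\<close> compensates; a union bound and
  the Borel-Cantelli lemma conclude.  The statement about the lower limit is the one about the
  upper limit for \<open>-X\<close>.
\<close>

section \<open>Sublinear expectations and capacities\<close>

lemma abs_le_vnorm: "i < n \<Longrightarrow> \<bar>x i\<bar> \<le> vnorm n x"
  using member_le_L2_set[of "{..<n}" i "\<lambda>i. \<bar>x i\<bar>"] by (simp add: vnorm_def L2_set_def)

lemma vnorm_nonneg: "0 \<le> vnorm n x"
  by (simp add: vnorm_def L2_set_nonneg)

section \<open>Closure properties of \<open>H\<close> and moment inequalities for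
  \<open>E\<close>\<close>

context sublinear_expectation_space
begin

text \<open>The lattice and product operations on \<open>H\<close> all come from this two-variable
  case of \<open>H_comp\<close>; a local Lipschitz constant of linear growth is what the product
  requires.\<close>

lemma H_comp2:
  fixes f :: "real \<Rightarrow> real \<Rightarrow> real"
  assumes X: "X \<in> H" and Y: "Y \<in> H"
    and f: "\<And>a b a' b'. \<bar>f a b - f a' b'\<bar>
      \<le> (1 + \<bar>a\<bar> + \<bar>b\<bar> + \<bar>a'\<bar> + \<bar>b'\<bar>) * (\<bar>a - a'\<bar> + \<bar>b - b'\<bar>)"
  shows "(\<lambda>\<omega>. f (X \<omega>) (Y \<omega>)) \<in> H"
proof -
  define \<phi> where "\<phi> x = f (x 0) (x (1::nat))" for x
  have "\<phi> \<in> C_l_Lip 2"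
    unfolding C_l_Lip_def
  \<comment> \<open>The constant 4 is 2 times 2: one norm bounds two coordinates, both in the growth
    factor and in the increment.\<close>
  proof (intro CollectI exI[of _ "4::real"] exI[of _ "1::nat"] conjI allI)
    fix x y :: "nat \<Rightarrow> real"
    define d where "d = vnorm 2 (\<lambda>i. x i - y i)"
    have d: "\<bar>x 0 - y 0\<bar> \<le> d" "\<bar>x 1 - y 1\<bar> \<le> d" "0 \<le> d"
      unfolding d_def using abs_le_vnorm[of _ 2 "\<lambda>i. x i - y i"] by (auto simp: vnorm_nonneg)
    have v: "\<bar>x 0\<bar> \<le> vnorm 2 x" "\<bar>x 1\<bar> \<le> vnorm 2 x" "\<bar>y 0\<bar> \<le> vnorm 2 y" "\<bar>y 1\<bar> \<le> vnorm 2 y"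
      by (auto intro: abs_le_vnorm)
    have "\<bar>\<phi> x - \<phi> y\<bar> \<le> (1 + \<bar>x 0\<bar> + \<bar>x 1\<bar> + \<bar>y 0\<bar> + \<bar>y 1\<bar>) * (\<bar>x 0 - y 0\<bar> + \<bar>x 1 - y 1\<bar>)"
      unfolding \<phi>_def by (rule f)
    also have "\<dots> \<le> (2 * (1 + vnorm 2 x + vnorm 2 y)) * (2 * d)"
      by (rule mult_mono) (use d v in auto)
    finally show "\<bar>\<phi> x - \<phi> y\<bar> \<le> 4 * (1 + vnorm 2 x ^ 1 + vnorm 2 y ^ 1) * vnorm 2 (\<lambda>i. x i - y i)"
      by (simp add: d_def algebra_simps)
  qed simp
  from H_comp[of 2 "\<lambda>i. if i = 0 then X else Y", OF _ _ this] X Y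
  show ?thesis by (simp add: \<phi>_def)
qed

lemma H_mult: "X \<in> H \<Longrightarrow> Y \<in> H \<Longrightarrow> (\<lambda>\<omega>. X \<omega> * Y \<omega>) \<in> H"
proof (rule H_comp2[where f = "\<lambda>a b. a * b"])
  fix a b a' b' :: real
  have "\<bar>a * b - a' * b'\<bar> = \<bar>a * (b - b') + b' * (a - a')\<bar>" by (simp add: algebra_simps)
  also have "\<dots> \<le> \<bar>a\<bar> * \<bar>b - b'\<bar> + \<bar>b'\<bar> * \<bar>a - a'\<bar>"
    by (metis abs_mult abs_triangle_ineq)
  also have "\<dots> \<le> (1 + \<bar>a\<bar> + \<bar>b\<bar> + \<bar>a'\<bar> + \<bar>b'\<bar>) * \<bar>b - b'\<bar> + (1 + \<bar>a\<bar> + \<bar>b\<bar> + \<bar>a'\<bar> + \<bar>b'\<bar>) * \<bar>a - a'\<bar>"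
    by (intro add_mono mult_right_mono) auto
  finally show "\<bar>a * b - a' * b'\<bar> \<le> (1 + \<bar>a\<bar> + \<bar>b\<bar> + \<bar>a'\<bar> + \<bar>b'\<bar>) * (\<bar>a - a'\<bar> + \<bar>b - b'\<bar>)"
    by (simp add: algebra_simps)
qed

lemma H_comp2_lipschitz:
  fixes f :: "real \<Rightarrow> real \<Rightarrow> real"
  assumes X: "X \<in> H" and Y: "Y \<in> H"
    and f: "\<And>a b a' b'. \<bar>f a b - f a' b'\<bar> \<le> \<bar>a - a'\<bar> + \<bar>b - b'\<bar>"
  shows "(\<lambda>\<omega>. f (X \<omega>) (Y \<omega>)) \<in> H"
proof (rule H_comp2[OF X Y])
  fix a b a' b' :: real
  have "1 * (\<bar>a - a'\<bar> + \<bar>b - b'\<bar>) \<le> (1 + \<bar>a\<bar> + \<bar>b\<bar> + \<bar>a'\<bar> + \<bar>b'\<bar>) * (\<bar>a - a'\<bar> + \<bar>b - b'\<bar>)"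
    by (rule mult_right_mono) auto
  with f[of a b a' b'] show "\<bar>f a b - f a' b'\<bar> \<le> (1 + \<bar>a\<bar> + \<bar>b\<bar> + \<bar>a'\<bar> + \<bar>b'\<bar>) * (\<bar>a - a'\<bar> + \<bar>b - b'\<bar>)"
    unfolding mult_1 by (rule order_trans)
qed

lemma H_max: "X \<in> H \<Longrightarrow> Y \<in> H \<Longrightarrow> (\<lambda>\<omega>. max (X \<omega>) (Y \<omega>)) \<in> H"
  by (rule H_comp2_lipschitz, assumption, assumption) linarith

lemma H_min: "X \<in> H \<Longrightarrow> Y \<in> H \<Longrightarrow> (\<lambda>\<omega>. min (X \<omega>) (Y \<omega>)) \<in> H"
  by (rule H_comp2_lipschitz, assumption, assumption) linarith

lemma H_const: "(\<lambda>_. c) \<in> H"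
  using H_comp2_lipschitz[OF H_zero H_zero, of "\<lambda>_ _. c"] by simp

lemma H_uminus: "X \<in> H \<Longrightarrow> (\<lambda>\<omega>. - X \<omega>) \<in> H"
  using H_scale[of X "-1"] by simp

lemma H_diff: "X \<in> H \<Longrightarrow> Y \<in> H \<Longrightarrow> (\<lambda>\<omega>. X \<omega> - Y \<omega>) \<in> H"
  using H_add[OF _ H_uminus] by simp

lemma H_abs: "X \<in> H \<Longrightarrow> (\<lambda>\<omega>. \<bar>X \<omega>\<bar>) \<in> H"
  by (rule H_comp2_lipschitz[where f = "\<lambda>a b. \<bar>a\<bar>"], assumption, assumption) linarith

lemma H_power2: "X \<in> H \<Longrightarrow> (\<lambda>\<omega>. (X \<omega>)\<^sup>2) \<in> H"
  using H_mult[of X X] by (simp add: power2_eq_square)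

lemma H_sum: "(\<And>i. i \<in> I \<Longrightarrow> X i \<in> H) \<Longrightarrow> (\<lambda>\<omega>. \<Sum>i\<in>I. X i \<omega>) \<in> H"
  by (induction I rule: infinite_finite_induct) (auto intro: H_zero H_add)

lemma H_truncate: "X \<in> H \<Longrightarrow> truncate c X \<in> H"
  unfolding truncate_def by (intro H_max H_min H_const)

lemmas H_intros = H_add H_diff H_uminus H_scale H_mult H_max H_min H_const H_abs H_power2 H_sum
  H_truncate

lemma E_zero: "E (\<lambda>_. 0) = 0"
  by (rule E_const)

lemma E_nonneg: "X \<in> H \<Longrightarrow> (\<And>\<omega>. \<omega> \<in> space M \<Longrightarrow> 0 \<le> X \<omega>) \<Longrightarrow> 0 \<le> E X"
  using E_mono[OF H_zero] E_zero by fastforce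

lemma E_sum_le: "finite I \<Longrightarrow> (\<And>i. i \<in> I \<Longrightarrow> X i \<in> H) \<Longrightarrow> E (\<lambda>\<omega>. \<Sum>i\<in>I. X i \<omega>) \<le> (\<Sum>i\<in>I. E (X i))"
proof (induction I rule: finite_induct)
  case (insert i I)
  then have "E (\<lambda>\<omega>. X i \<omega> + (\<Sum>i\<in>I. X i \<omega>)) \<le> E (X i) + E (\<lambda>\<omega>. \<Sum>i\<in>I. X i \<omega>)"
    by (intro E_subadd H_intros) auto
  with insert show ?case by simp
qed (simp add: E_zero)

text \<open>For a constant, subadditivity is an equality because adding \<open>- c\<close> undoes
  adding \<open>c\<close>.\<close>

lemma E_add_const: "X \<in> H \<Longrightarrow> E (\<lambda>\<omega>. X \<omega> + c) = E X + c"
proof (rule antisym)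
  assume X: "X \<in> H"
  show "E (\<lambda>\<omega>. X \<omega> + c) \<le> E X + c"
    using E_subadd[OF X H_const[of c]] by (simp add: E_const)
  show "E X + c \<le> E (\<lambda>\<omega>. X \<omega> + c)"
    using E_subadd[OF H_add[OF X H_const[of c]] H_const[of "- c"]] by (simp add: E_const)
qed

lemma E_abs_diff_le:
  assumes X: "X \<in> H" and Y: "Y \<in> H"
  shows "\<bar>E X - E Y\<bar> \<le> E (\<lambda>\<omega>. \<bar>X \<omega> - Y \<omega>\<bar>)"
proof -
  have *: "E X \<le> E Y + E (\<lambda>\<omega>. \<bar>X \<omega> - Y \<omega>\<bar>)" if "X \<in> H" "Y \<in> H" for X Y
  proof -
    have "E X \<le> E (\<lambda>\<omega>. Y \<omega> + \<bar>X \<omega> - Y \<omega>\<bar>)"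
      using that by (intro E_mono H_intros) auto
    also have "\<dots> \<le> E Y + E (\<lambda>\<omega>. \<bar>X \<omega> - Y \<omega>\<bar>)"
      using that by (intro E_subadd H_intros)
    finally show ?thesis .
  qed
  show ?thesis
    using *[OF X Y] *[OF Y X] by (simp add: abs_minus_commute abs_le_iff)
qed

text \<open>With \<open>e = E X\<close>, apply \<open>E\<close> to
  \<open>2 * e * X \<le> X^2 + e^2\<close>, the expansion of
  \<open>(X - e)^2 \<ge> 0\<close>.\<close>

lemma E_square_le: "X \<in> H \<Longrightarrow> (E X)\<^sup>2 \<le> E (\<lambda>\<omega>. (X \<omega>)\<^sup>2)"
proof -
  assume X: "X \<in> H"
  define e where "e = E X"
  have "2 * e * e \<le> E (\<lambda>\<omega>. (2 * e) * X \<omega>)"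
  proof (cases "0 \<le> e")
    case True
    then show ?thesis using X by (simp add: E_pos_hom e_def)
  next
    \<comment> \<open>For negative \<open>e\<close>, homogeneity applies to \<open>- X\<close> with
      the factor \<open>-2 * e\<close>, and subadditivity bounds the expectation of
      \<open>- X\<close> below by \<open>- e\<close>.\<close>
    case False
    have "0 \<le> E X + E (\<lambda>\<omega>. - X \<omega>)"
      using E_subadd[OF X H_uminus[OF X]] by (simp add: E_zero)
    then have "(-2 * e) * (- e) \<le> (-2 * e) * E (\<lambda>\<omega>. - X \<omega>)"
      using False by (intro mult_left_mono) (auto simp: e_def)
    then show ?thesis
      using E_pos_hom[OF H_uminus[OF X], of "-2 * e"] False by simp
  qed
  also have "\<dots> \<le> E (\<lambda>\<omega>. (X \<omega>)\<^sup>2 + e\<^sup>2)"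
  proof (intro E_mono H_intros X)
    fix \<omega>
    have "0 \<le> (X \<omega> - e)\<^sup>2" by simp
    then show "2 * e * X \<omega> \<le> (X \<omega>)\<^sup>2 + e\<^sup>2"
      by (simp add: power2_eq_square algebra_simps)
  qed
  also have "\<dots> = E (\<lambda>\<omega>. (X \<omega>)\<^sup>2) + e\<^sup>2"
    by (intro E_add_const H_intros X)
  finally show ?thesis by (simp add: e_def power2_eq_square)
qed

text \<open>The 4 arises from \<open>(x - e)^2 \<le> 2 * x^2 + 2 * e^2\<close>, where
  \<open>e^2\<close> is again at most the second moment.\<close>

lemma E_centered_square_le:
  assumes X: "X \<in> H"
  shows "E (\<lambda>\<omega>. (X \<omega> - E X)\<^sup>2) \<le> 4 * E (\<lambda>\<omega>. (X \<omega>)\<^sup>2)"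
proof -
  have "E (\<lambda>\<omega>. (X \<omega> - E X)\<^sup>2) \<le> E (\<lambda>\<omega>. 2 * (X \<omega>)\<^sup>2 + 2 * (E X)\<^sup>2)"
  proof (intro E_mono H_intros X)
    fix \<omega>
    have "0 \<le> (X \<omega> + E X)\<^sup>2" by simp
    then show "(X \<omega> - E X)\<^sup>2 \<le> 2 * (X \<omega>)\<^sup>2 + 2 * (E X)\<^sup>2"
      by (simp add: power2_eq_square algebra_simps)
  qed
  also have "\<dots> = 2 * E (\<lambda>\<omega>. (X \<omega>)\<^sup>2) + 2 * (E X)\<^sup>2"
    using X by (simp add: E_add_const E_pos_hom H_intros)
  finally show ?thesis using E_square_le[OF X] by linarith
qed

section \<open>The capacity \<open>V\<close>: comparison with \<open>E\<close> and finite
  subadditivity\<close>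

abbreviation V :: "'a set \<Rightarrow> real" where
  "V \<equiv> V_hat M H E"

lemma V_bdd_below: "bdd_below {E \<xi> | \<xi>. \<xi> \<in> H \<and> (\<forall>\<omega>\<in>space M. indicator A \<omega> \<le> \<xi> \<omega>)}"
proof (intro bdd_belowI[of _ 0], clarify)
  fix \<xi> assume "\<xi> \<in> H" "\<forall>\<omega>\<in>space M. indicator A \<omega> \<le> \<xi> \<omega>"
  then show "0 \<le> E \<xi>"
    by (intro E_nonneg) (auto intro: order_trans[OF indicator_pos_le])
qed

lemma V_le: "\<xi> \<in> H \<Longrightarrow> (\<And>\<omega>. \<omega> \<in> space M \<Longrightarrow> indicator A \<omega> \<le> \<xi> \<omega>) \<Longrightarrow> V A \<le> E \<xi>"
  unfolding V_hat_def by (rule cInf_lower[OF _ V_bdd_below]) auto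

lemma V_greatest:
  assumes "\<And>\<xi>. \<xi> \<in> H \<Longrightarrow> (\<And>\<omega>. \<omega> \<in> space M \<Longrightarrow> indicator A \<omega> \<le> \<xi> \<omega>) \<Longrightarrow> b \<le> E \<xi>"
  shows "b \<le> V A"
  unfolding V_hat_def
proof (rule cInf_greatest)
  have "E (\<lambda>_. 1) \<in> {E \<xi> |\<xi>. \<xi> \<in> H \<and> (\<forall>\<omega>\<in>space M. indicator A \<omega> \<le> \<xi> \<omega>)}"
    using H_const[of 1] by (auto simp: indicator_def)
  then show "{E \<xi> |\<xi>. \<xi> \<in> H \<and> (\<forall>\<omega>\<in>space M. indicator A \<omega> \<le> \<xi> \<omega>)} \<noteq> {}" by blast
qed (use assms in auto)

lemma V_nonneg: "0 \<le> V A"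
  by (rule V_greatest) (auto intro!: E_nonneg intro: order_trans[OF indicator_pos_le])

lemma V_mono:
  assumes "\<And>\<omega>. \<omega> \<in> space M \<Longrightarrow> \<omega> \<in> A \<Longrightarrow> \<omega> \<in> B"
  shows "V A \<le> V B"
proof (rule V_greatest, rule V_le)
  fix \<xi> :: "'a \<Rightarrow> real" and \<omega>
  assume \<xi>: "\<And>\<omega>. \<omega> \<in> space M \<Longrightarrow> indicator B \<omega> \<le> \<xi> \<omega>" and \<omega>: "\<omega> \<in> space M"
  have "indicator A \<omega> \<le> (indicator B \<omega> :: real)"
    using assms[OF \<omega>] by (auto simp: indicator_def)
  with \<xi>[OF \<omega>] show "indicator A \<omega> \<le> \<xi> \<omega>" by linarith
qed

lemma V_space: "V (space M) = 1"
proof (rule antisym)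
  show "V (space M) \<le> 1"
    using V_le[OF H_const[of 1], of "space M"] by (simp add: E_const)
  show "1 \<le> V (space M)"
  proof (rule V_greatest)
    fix \<xi> assume "\<xi> \<in> H" "\<And>\<omega>. \<omega> \<in> space M \<Longrightarrow> indicator (space M) \<omega> \<le> \<xi> \<omega>"
    then have "E (\<lambda>_. 1) \<le> E \<xi>" by (intro E_mono H_const) auto
    then show "1 \<le> E \<xi>" by (simp add: E_const)
  qed
qed

lemma V_approx:
  assumes "0 < \<epsilon>"
  obtains \<xi> where "\<xi> \<in> H" "\<And>\<omega>. \<omega> \<in> space M \<Longrightarrow> indicator A \<omega> \<le> \<xi> \<omega>" "E \<xi> \<le> V A + \<epsilon>"
proof -
  have "\<exists>\<xi>. \<xi> \<in> H \<and> (\<forall>\<omega>\<in>space M. indicator A \<omega> \<le> \<xi> \<omega>) \<and> E \<xi> \<le> V A + \<epsilon>"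
  proof (rule ccontr)
    assume "\<not> ?thesis"
    then have "V A + \<epsilon> \<le> V A" by (intro V_greatest) (meson linear)
    with assms show False by simp
  qed
  with that show thesis by blast
qed

text \<open>Turns a pointwise bound by weighted indicators into a bound by capacities. The infimum
  in \<open>V\<close> need not be attained, so near-optimal majorants of the indicators are
  used.\<close>

lemma E_le_sum_V:
  assumes X: "X \<in> H" and I: "finite I" and w: "\<And>i. i \<in> I \<Longrightarrow> 0 \<le> w i"
    and le: "\<And>\<omega>. \<omega> \<in> space M \<Longrightarrow> X \<omega> \<le> a + (\<Sum>i\<in>I. w i * indicator (A i) \<omega>)"
  shows "E X \<le> a + (\<Sum>i\<in>I. w i * V (A i))"
proof (rule field_le_epsilon)
  fix e :: real assume "0 < e"
  \<comment> \<open>The slack is spread over the total weight; the added 1 keeps the quotient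
    positive when all weights vanish.\<close>
  define d where "d = e / (1 + (\<Sum>i\<in>I. w i))"
  have s: "0 \<le> (\<Sum>i\<in>I. w i)" using w by (rule sum_nonneg)
  with \<open>0 < e\<close> have d: "0 < d" "(\<Sum>i\<in>I. w i) * d \<le> e" by (auto simp: d_def field_simps)
  have "\<exists>\<xi>. \<xi> \<in> H \<and> (\<forall>\<omega>\<in>space M. indicator (A i) \<omega> \<le> \<xi> \<omega>) \<and> E \<xi> \<le> V (A i) + d" for i
    using V_approx[OF d(1)] by metis
  then obtain \<xi> where \<xi>: "\<xi> i \<in> H" "\<And>\<omega>. \<omega> \<in> space M \<Longrightarrow> indicator (A i) \<omega> \<le> \<xi> i \<omega>"
      "E (\<xi> i) \<le> V (A i) + d" for i
    by metis
  have "E X \<le> E (\<lambda>\<omega>. (\<Sum>i\<in>I. w i * \<xi> i \<omega>) + a)"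
  proof (intro E_mono H_intros X \<xi>(1))
    fix \<omega> assume "\<omega> \<in> space M"
    then have "(\<Sum>i\<in>I. w i * indicator (A i) \<omega>) \<le> (\<Sum>i\<in>I. w i * \<xi> i \<omega>)"
      using w \<xi>(2) by (intro sum_mono mult_left_mono) auto
    then show "X \<omega> \<le> (\<Sum>i\<in>I. w i * \<xi> i \<omega>) + a" using le[OF \<open>\<omega> \<in> space M\<close>] by linarith
  qed
  also have "\<dots> = E (\<lambda>\<omega>. \<Sum>i\<in>I. w i * \<xi> i \<omega>) + a"
    by (intro E_add_const H_intros \<xi>(1))
  also have "E (\<lambda>\<omega>. \<Sum>i\<in>I. w i * \<xi> i \<omega>) \<le> (\<Sum>i\<in>I. E (\<lambda>\<omega>. w i * \<xi> i \<omega>))"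
    by (intro E_sum_le I H_intros \<xi>(1))
  also have "\<dots> = (\<Sum>i\<in>I. w i * E (\<xi> i))"
    using w by (intro sum.cong refl E_pos_hom \<xi>(1))
  also have "\<dots> \<le> (\<Sum>i\<in>I. w i * (V (A i) + d))"
    using w \<xi>(3) by (intro sum_mono mult_left_mono)
  also have "\<dots> = (\<Sum>i\<in>I. w i * V (A i)) + (\<Sum>i\<in>I. w i) * d"
    by (simp add: algebra_simps sum.distrib sum_distrib_left)
  finally show "E X \<le> a + (\<Sum>i\<in>I. w i * V (A i)) + e" using d(2) by linarith
qed

text \<open>Near-optimal majorants of the single indicators add up to a majorant of the indicator of
  the union.\<close>

lemma V_UN_le:
  assumes "finite I"
  shows "V (\<Union>i\<in>I. A i) \<le> (\<Sum>i\<in>I. V (A i))"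
proof (rule field_le_epsilon)
  fix e :: real assume "0 < e"
  define d where "d = e / (1 + card I)"
  from \<open>0 < e\<close> have d: "0 < d" "card I * d \<le> e" by (auto simp: d_def field_simps)
  have "\<exists>\<xi>. \<xi> \<in> H \<and> (\<forall>\<omega>\<in>space M. indicator (A i) \<omega> \<le> \<xi> \<omega>) \<and> E \<xi> \<le> V (A i) + d" for i
    using V_approx[OF d(1)] by metis
  then obtain \<xi> where \<xi>: "\<xi> i \<in> H" "\<And>\<omega>. \<omega> \<in> space M \<Longrightarrow> indicator (A i) \<omega> \<le> \<xi> i \<omega>"
      "E (\<xi> i) \<le> V (A i) + d" for i
    by metis
  have "V (\<Union>i\<in>I. A i) \<le> E (\<lambda>\<omega>. \<Sum>i\<in>I. \<xi> i \<omega>)"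
  proof (intro V_le H_intros \<xi>(1))
    fix \<omega> assume "\<omega> \<in> space M"
    then have "(\<Sum>i\<in>I. indicator (A i) \<omega>) \<le> (\<Sum>i\<in>I. \<xi> i \<omega>)"
      using \<xi>(2) by (intro sum_mono)
    moreover have "indicator (\<Union>i\<in>I. A i) \<omega> \<le> (\<Sum>i\<in>I. indicator (A i) \<omega> :: real)"
    proof (cases "\<omega> \<in> (\<Union>i\<in>I. A i)")
      case True
      then obtain i where i: "i \<in> I" "\<omega> \<in> A i" by blast
      then have "indicator (A i) \<omega> \<le> (\<Sum>i\<in>I. indicator (A i) \<omega> :: real)"
        using assms by (intro member_le_sum) auto
      with i True show ?thesis by simp
    qed (simp add: sum_nonneg)
    ultimately show "indicator (\<Union>i\<in>I. A i) \<omega> \<le> (\<Sum>i\<in>I. \<xi> i \<omega>)" by linarith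
  qed
  also have "\<dots> \<le> (\<Sum>i\<in>I. E (\<xi> i))"
    by (intro E_sum_le assms \<xi>(1))
  also have "\<dots> \<le> (\<Sum>i\<in>I. V (A i) + d)"
    using \<xi>(3) by (intro sum_mono)
  also have "\<dots> = (\<Sum>i\<in>I. V (A i)) + card I * d"
    by (simp add: sum.distrib)
  finally show "V (\<Union>i\<in>I. A i) \<le> (\<Sum>i\<in>I. V (A i)) + e" using d(2) by linarith
qed

lemma V_Un_le: "V (A \<union> B) \<le> V A + V B"
  using V_UN_le[of "{0, Suc 0}" "\<lambda>i. if i = 0 then A else B"] by (simp add: Un_commute[of B A])

section \<open>Null sets of the outer capacity and Borel-Cantelli\<close>

lemma V_star_eq_0I:
  assumes "\<And>e. 0 < e \<Longrightarrow> \<exists>B. range B \<subseteq> sets M \<and> A \<subseteq> (\<Union>n. B n) \<and> (\<Sum>n. ennreal (V (B n))) \<le> ennreal e"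
  shows "V_star M H E A = 0"
proof -
  have "V_star M H E A \<le> 0 + ennreal e" if "0 < e" for e
  proof -
    from assms[OF that] obtain B where "range B \<subseteq> sets M" "A \<subseteq> (\<Union>n. B n)" "(\<Sum>n. ennreal (V (B n))) \<le> ennreal e"
      by blast
    then show ?thesis
      unfolding V_star_def by (intro Inf_lower2[of "\<Sum>n. ennreal (V (B n))"]) auto
  qed
  then have "V_star M H E A \<le> 0" by (rule ennreal_le_epsilon) auto
  then show ?thesis by simp
qed

lemma V_star_mono: "A \<subseteq> B \<Longrightarrow> V_star M H E A \<le> V_star M H E B"
  unfolding V_star_def by (rule Inf_superset_mono) blast

text \<open>Countable unions are treated at the level of covers: the budgets
  \<open>e / 2^(p+1)\<close> for the separate sets sum to \<open>e\<close>.\<close>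

lemma V_star_null_UN:
  assumes "\<And>p::nat. V_star M H E (A p) = 0"
  shows "V_star M H E (\<Union>p. A p) = 0"
proof (rule V_star_eq_0I)
  fix e :: real assume "0 < e"
  have "\<exists>B. range B \<subseteq> sets M \<and> A p \<subseteq> (\<Union>n. B n) \<and> (\<Sum>n. ennreal (V (B n))) < ennreal (e * (1/2) ^ Suc p)" for p
  proof -
    have "V_star M H E (A p) < ennreal (e * (1/2) ^ Suc p)"
      using assms[of p] \<open>0 < e\<close> by (simp add: ennreal_zero_less_mult_iff)
    then show ?thesis unfolding V_star_def Inf_less_iff by blast
  qed
  then obtain B where "\<forall>p. range (B p) \<subseteq> sets M \<and> A p \<subseteq> (\<Union>n. B p n) \<and>
      (\<Sum>n. ennreal (V (B p n))) < ennreal (e * (1/2) ^ Suc p)"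
    by (rule choice[OF allI, THEN exE])
  then have B: "range (B p) \<subseteq> sets M" "A p \<subseteq> (\<Union>n. B p n)"
      "(\<Sum>n. ennreal (V (B p n))) < ennreal (e * (1/2) ^ Suc p)" for p
    by blast+
  \<comment> \<open>The pairing bijection lists the double array of covering sets as one
    sequence.\<close>
  define B' where "B' n = (case prod_decode n of (p, k) \<Rightarrow> B p k)" for n
  have "(\<Sum>n. ennreal (V (B' n))) = (\<Sum>p. \<Sum>k. ennreal (V (B p k)))"
    by (subst suminf_ennreal_2dimen[where f = "\<lambda>(p, k). ennreal (V (B p k))", symmetric])
      (auto simp: B'_def comp_def split: prod.split intro!: arg_cong[where f = suminf])
  also have "\<dots> \<le> (\<Sum>p. ennreal (e * (1/2) ^ Suc p))"
    using B(3) by (intro suminf_le) (auto intro: less_imp_le)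
  also have "\<dots> = ennreal e"
    using \<open>0 < e\<close> sums_mult[OF power_half_series, of e]
    by (subst suminf_ennreal2) (auto simp: sums_iff)
  finally have "(\<Sum>n. ennreal (V (B' n))) \<le> ennreal e" .
  moreover have "range B' \<subseteq> sets M" using B(1) by (auto simp: B'_def split: prod.split)
  moreover have "(\<Union>p. A p) \<subseteq> (\<Union>n. B' n)"
  proof
    fix x assume "x \<in> (\<Union>p. A p)"
    then obtain p k where "x \<in> B p k" using B(2) by blast
    then have "x \<in> B' (prod_encode (p, k))" by (simp add: B'_def)
    then show "x \<in> (\<Union>n. B' n)" by blast
  qed
  ultimately show "\<exists>B. range B \<subseteq> sets M \<and> (\<Union>p. A p) \<subseteq> (\<Union>n. B n) \<and> (\<Sum>n. ennreal (V (B n))) \<le> ennreal e"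
    by blast
qed

lemma V_star_null_Un:
  assumes "V_star M H E A = 0" "V_star M H E B = 0"
  shows "V_star M H E (A \<union> B) = 0"
proof -
  have "V_star M H E (A \<union> B) \<le> V_star M H E (\<Union>p. if p = (0::nat) then A else B)"
    by (intro V_star_mono) (auto split: if_splits)
  also have "\<dots> = 0" using assms by (intro V_star_null_UN) auto
  finally show ?thesis by simp
qed

text \<open>Every tail of the family \<open>D\<close> is itself a cover admissible for
  \<open>V_star\<close>, so the tails of the convergent series bound \<open>V_star\<close> of
  \<open>A\<close>.\<close>

lemma Borel_Cantelli:
  assumes D: "\<And>k. D k \<in> sets M" and s: "summable (\<lambda>k. V (D k))"
    and A: "\<And>K. A \<subseteq> (\<Union>k\<in>{K..}. D k)"
  shows "V_star M H E A = 0"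
proof (rule V_star_eq_0I)
  fix e :: real assume "0 < e"
  from suminf_exist_split[OF this s] obtain K where K: "norm (\<Sum>k. V (D (k + K))) < e" by auto
  have "(\<Sum>k. ennreal (V (D (k + K)))) = ennreal (\<Sum>k. V (D (k + K)))"
    by (rule suminf_ennreal2[OF V_nonneg summable_ignore_initial_segment[OF s]])
  also have "\<dots> \<le> ennreal e" using K by (intro ennreal_leI) auto
  finally have "(\<Sum>k. ennreal (V (D (k + K)))) \<le> ennreal e" .
  moreover have "A \<subseteq> (\<Union>k. D (k + K))"
  proof
    fix x assume "x \<in> A"
    with A obtain k where "k \<ge> K" "x \<in> D k" by blast
    then have "x \<in> D ((k - K) + K)" by simp
    then show "x \<in> (\<Union>k. D (k + K))" by blast
  qed
  ultimately show "\<exists>B. range B \<subseteq> sets M \<and> A \<subseteq> (\<Union>n. B n) \<and> (\<Sum>n. ennreal (V (B n))) \<le> ennreal e"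
    using D by (intro exI[of _ "\<lambda>k. D (k + K)"]) auto
qed

end

section \<open>A maximal inequality for independent summands\<close>

text \<open>Indices run over a full initial segment; a sum over a sparse class is obtained from a
  \<open>g j\<close> that vanishes off the class, which avoids renumbering the variables.\<close>

definition psum :: "(nat \<Rightarrow> real \<Rightarrow> real) \<Rightarrow> nat \<Rightarrow> (nat \<Rightarrow> real) \<Rightarrow> real" where
  "psum g n x = (\<Sum>j<n. g j (x j))"

primrec pmax :: "(nat \<Rightarrow> real \<Rightarrow> real) \<Rightarrow> nat \<Rightarrow> (nat \<Rightarrow> real) \<Rightarrow> real" where
  "pmax g 0 x = 0"
| "pmax g (Suc n) x = max (pmax g n x) (psum g (Suc n) x)"

text \<open>
  Independence is only available for Lipschitz test functions, so stopping when the running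
  maximum exceeds \<open>a\<close> is replaced by a weight that decreases from \<open>1\<close> at \<open>a\<close> to \<open>0\<close> at \<open>2a\<close>.
\<close>

definition stop_weight :: "real \<Rightarrow> real \<Rightarrow> real" where
  "stop_weight a \<mu> = max 0 (min 1 (2 - \<mu> / a))"

text \<open>A bounded Lipschitz substitute for the coefficient \<open>s^+\<close> of the next
  increment. The cap at \<open>2 * a\<close> does not change the product, since the weight is 0 once
  the running maximum reaches \<open>2 * a\<close>.\<close>

definition stopped :: "(nat \<Rightarrow> real \<Rightarrow> real) \<Rightarrow> real \<Rightarrow> nat \<Rightarrow> (nat \<Rightarrow> real) \<Rightarrow> real" where
  "stopped g a n x = min (max 0 (psum g n x)) (2 * a) * stop_weight a (pmax g n x)"

lemma psum_0: "psum g 0 x = 0"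
  by (simp add: psum_def)

lemma psum_Suc: "psum g (Suc n) x = psum g n x + g n (x n)"
  by (simp add: psum_def)

lemma psum_le_pmax: "i \<le> n \<Longrightarrow> psum g i x \<le> pmax g n x"
proof (induction n)
  case (Suc n)
  then show ?case by (cases "i = Suc n") auto
qed (simp add: psum_0)

lemma stop_weight_bounds: "0 \<le> stop_weight a \<mu>" "stop_weight a \<mu> \<le> 1"
  by (auto simp: stop_weight_def)

lemma stop_weight_eq_0: "0 < a \<Longrightarrow> 2 * a \<le> \<mu> \<Longrightarrow> stop_weight a \<mu> = 0"
  by (simp add: stop_weight_def field_simps)

lemma stop_weight_eq_1: "0 < a \<Longrightarrow> \<mu> \<le> a \<Longrightarrow> stop_weight a \<mu> = 1"
  by (simp add: stop_weight_def field_simps min_def)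

lemma stop_weight_antimono: "0 < a \<Longrightarrow> \<mu> \<le> \<nu> \<Longrightarrow> stop_weight a \<nu> \<le> stop_weight a \<mu>"
  unfolding stop_weight_def by (intro max.mono min.mono diff_left_mono divide_right_mono) auto

lemma stopped_nonneg: "0 < a \<Longrightarrow> 0 \<le> stopped g a n x"
  by (simp add: stopped_def stop_weight_bounds)

lemma stopped_le: "0 < a \<Longrightarrow> stopped g a n x \<le> 2 * a"
  unfolding stopped_def
  using mult_mono[of "min (max 0 (psum g n x)) (2 * a)" "2 * a" "stop_weight a (pmax g n x)" 1]
  by (simp add: stop_weight_bounds)

text \<open>
  A lower bound for the expected value of \<open>((S stopped at level b)\<^sup>+)\<^sup>2\<close> over a uniformly distributed
  level \<open>b \<in> [a, 2a]\<close>, in terms of the current sum \<open>s\<close> and the running maximum \<open>\<mu>\<close>.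
\<close>

definition stop_potential :: "real \<Rightarrow> real \<Rightarrow> real \<Rightarrow> real" where
  "stop_potential a s \<mu> = a\<^sup>2 * (1 - stop_weight a \<mu>) + stop_weight a \<mu> * (max 0 s)\<^sup>2"

lemma stop_potential_nonneg: "0 \<le> stop_potential a s \<mu>"
  by (simp add: stop_potential_def stop_weight_bounds)

text \<open>Updating the running maximum cannot raise the potential: if the weight drops, the new
  sum is the new maximum and exceeds \<open>a\<close>, so part of its square is exchanged for the
  smaller \<open>a^2\<close>. What remains is the growth of the squared positive part.\<close>

lemma stop_potential_step:
  assumes a: "0 < a" and s: "s \<le> \<mu>"
  shows "stop_potential a (s + y) (max \<mu> (s + y))
    \<le> stop_potential a s \<mu> + (y\<^sup>2 + 2 * (min (max 0 s) (2 * a) * stop_weight a \<mu>) * y)"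
proof -
  define \<theta> where "\<theta> = stop_weight a \<mu>"
  have \<theta>: "0 \<le> \<theta>" "\<theta> \<le> 1" by (auto simp: \<theta>_def stop_weight_bounds)
  \<comment> \<open>A sum above \<open>2 * a\<close> forces \<open>\<mu>\<close> above
    \<open>2 * a\<close>, where the weight is 0.\<close>
  have 1: "min (max 0 s) (2 * a) * \<theta> = max 0 s * \<theta>"
    using a s stop_weight_eq_0[of a \<mu>] by (cases "s \<le> 2 * a") (auto simp: \<theta>_def)
  have 2: "(max 0 (s + y))\<^sup>2 \<le> (max 0 s)\<^sup>2 + 2 * max 0 s * y + y\<^sup>2"
  proof (cases "0 \<le> s")
    case True
    then have "(max 0 (s + y))\<^sup>2 \<le> (s + y)\<^sup>2" by (simp add: max_def)
    with True show ?thesis by (simp add: power2_sum)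
  next
    case False
    then have "\<bar>max 0 (s + y)\<bar> \<le> \<bar>y\<bar>" by auto
    then have "(max 0 (s + y))\<^sup>2 \<le> y\<^sup>2" by (rule abs_le_square_iff[THEN iffD1])
    with False show ?thesis by simp
  qed
  have "stop_potential a (s + y) (max \<mu> (s + y)) \<le> stop_potential a (s + y) \<mu>"
  proof (cases "max \<mu> (s + y) \<le> a")
    case True
    then show ?thesis using a by (simp add: stop_potential_def stop_weight_eq_1)
  next
    case False
    show ?thesis
    proof (cases "s + y \<le> \<mu>")
      case nle: False
      with False have "a < s + y" by auto
      then have "a\<^sup>2 \<le> (max 0 (s + y))\<^sup>2" using a by (intro power_mono) auto
      moreover have "stop_weight a (max \<mu> (s + y)) \<le> \<theta>"
        unfolding \<theta>_def using a by (intro stop_weight_antimono) auto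
      \<comment> \<open>This product is exactly the difference of the potentials with the old and
        the new weight.\<close>
      ultimately have "0 \<le> (\<theta> - stop_weight a (max \<mu> (s + y))) * ((max 0 (s + y))\<^sup>2 - a\<^sup>2)"
        by simp
      then show ?thesis by (simp add: stop_potential_def \<theta>_def algebra_simps)
    qed simp
  qed
  also have "\<dots> \<le> a\<^sup>2 * (1 - \<theta>) + \<theta> * ((max 0 s)\<^sup>2 + 2 * max 0 s * y + y\<^sup>2)"
    unfolding stop_potential_def \<theta>_def[symmetric] using \<theta> 2 by (intro add_left_mono mult_left_mono)
  also have "\<dots> \<le> stop_potential a s \<mu> + (y\<^sup>2 + 2 * (max 0 s * \<theta>) * y)"
    using mult_right_mono[OF \<theta>(2), of "y\<^sup>2"]
    by (simp add: stop_potential_def \<theta>_def[symmetric] algebra_simps)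
  finally show ?thesis unfolding 1[unfolded \<theta>_def] \<theta>_def .
qed

text \<open>The one-step estimate telescopes along each path; expectations enter only
  afterwards.\<close>

lemma stop_potential_le:
  assumes a: "0 < a"
  shows "stop_potential a (psum g n x) (pmax g n x)
    \<le> (\<Sum>j<n. (g j (x j))\<^sup>2 + 2 * stopped g a j x * g j (x j))"
proof (induction n)
  case 0
  then show ?case using a by (simp add: stop_potential_def psum_0 stop_weight_eq_1)
next
  case (Suc n)
  have "stop_potential a (psum g (Suc n) x) (pmax g (Suc n) x)
      \<le> stop_potential a (psum g n x) (pmax g n x) + ((g n (x n))\<^sup>2 + 2 * stopped g a n x * g n (x n))"
    using stop_potential_step[OF a psum_le_pmax[of n n g x], of "g n (x n)"]
    by (simp add: psum_Suc stopped_def)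
  with Suc show ?case by simp
qed

lemma psum_cong: "(\<And>j. j < n \<Longrightarrow> g j (x j) = g j (y j)) \<Longrightarrow> psum g n x = psum g n y"
  by (simp add: psum_def)

lemma pmax_cong: "(\<And>j. j < n \<Longrightarrow> g j (x j) = g j (y j)) \<Longrightarrow> pmax g n x = pmax g n y"
proof (induction n)
  case (Suc n)
  then have "psum g (Suc n) x = psum g (Suc n) y" by (intro psum_cong)
  with Suc show ?case by simp
qed simp

lemma stopped_cong: "(\<And>j. j < n \<Longrightarrow> g j (x j) = g j (y j)) \<Longrightarrow> stopped g a n x = stopped g a n y"
  unfolding stopped_def using psum_cong[of n g x y] pmax_cong[of n g x y] by simp

section \<open>Lipschitz functions of finitely many coordinates\<close>

definition vlip :: "nat \<Rightarrow> ((nat \<Rightarrow> real) \<Rightarrow> real) \<Rightarrow> bool" where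
  "vlip d F \<longleftrightarrow> (\<exists>L\<ge>0. \<forall>x y. \<bar>F x - F y\<bar> \<le> L * vnorm d (\<lambda>i. x i - y i))"

lemma vlipI: "0 \<le> L \<Longrightarrow> (\<And>x y. \<bar>F x - F y\<bar> \<le> L * vnorm d (\<lambda>i. x i - y i)) \<Longrightarrow> vlip d F"
  by (auto simp: vlip_def)

lemma vlip_const: "vlip d (\<lambda>_. c)"
  by (rule vlipI[of 0]) auto

lemma vlip_coord: "i < d \<Longrightarrow> vlip d (\<lambda>x. x i)"
  by (rule vlipI[of 1]) (auto intro: abs_le_vnorm)

text \<open>The estimate for \<open>f\<close> is demanded at attained values only. This covers
  products of bounded functions although multiplication is not globally Lipschitz.\<close>

lemma vlip_comp2:
  assumes F: "vlip d F" and G: "vlip d G" and K: "0 \<le> K"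
    and f: "\<And>x y. \<bar>f (F x) (G x) - f (F y) (G y)\<bar> \<le> K * (\<bar>F x - F y\<bar> + \<bar>G x - G y\<bar>)"
  shows "vlip d (\<lambda>x. f (F x) (G x))"
proof -
  from F obtain L where L: "L \<ge> 0" "\<And>x y. \<bar>F x - F y\<bar> \<le> L * vnorm d (\<lambda>i. x i - y i)"
    by (auto simp: vlip_def)
  from G obtain L' where L': "L' \<ge> 0" "\<And>x y. \<bar>G x - G y\<bar> \<le> L' * vnorm d (\<lambda>i. x i - y i)"
    by (auto simp: vlip_def)
  show ?thesis
  proof (rule vlipI[of "K * (L + L')"])
    fix x y
    have "\<bar>f (F x) (G x) - f (F y) (G y)\<bar> \<le> K * (\<bar>F x - F y\<bar> + \<bar>G x - G y\<bar>)" by (rule f)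
    also have "\<dots> \<le> K * (L * vnorm d (\<lambda>i. x i - y i) + L' * vnorm d (\<lambda>i. x i - y i))"
      using K L L' by (intro mult_left_mono add_mono)
    finally show "\<bar>f (F x) (G x) - f (F y) (G y)\<bar> \<le> K * (L + L') * vnorm d (\<lambda>i. x i - y i)"
      by (simp add: algebra_simps)
  qed (use K L L' in auto)
qed

lemma vlip_add: "vlip d F \<Longrightarrow> vlip d G \<Longrightarrow> vlip d (\<lambda>x. F x + G x)"
  by (rule vlip_comp2[where K = 1 and f = "(+)"]) auto

lemma vlip_diff: "vlip d F \<Longrightarrow> vlip d G \<Longrightarrow> vlip d (\<lambda>x. F x - G x)"
  by (rule vlip_comp2[where K = 1 and f = "(-)"]) auto

lemma vlip_max: "vlip d F \<Longrightarrow> vlip d G \<Longrightarrow> vlip d (\<lambda>x. max (F x) (G x))"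
proof (rule vlip_comp2[where K = 1 and f = max])
  show "\<bar>max (F x) (G x) - max (F y) (G y)\<bar> \<le> 1 * (\<bar>F x - F y\<bar> + \<bar>G x - G y\<bar>)" for x y
    unfolding mult_1 by linarith
qed simp_all

lemma vlip_min: "vlip d F \<Longrightarrow> vlip d G \<Longrightarrow> vlip d (\<lambda>x. min (F x) (G x))"
proof (rule vlip_comp2[where K = 1 and f = min])
  show "\<bar>min (F x) (G x) - min (F y) (G y)\<bar> \<le> 1 * (\<bar>F x - F y\<bar> + \<bar>G x - G y\<bar>)" for x y
    unfolding mult_1 by linarith
qed simp_all

lemma vlip_divide: "vlip d F \<Longrightarrow> vlip d (\<lambda>x. F x / c)"
  by (rule vlip_comp2[where K = "\<bar>1 / c\<bar>" and f = "\<lambda>u v. u / c" and G = "\<lambda>_. 0"])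
    (auto intro: vlip_const simp: diff_divide_distrib[symmetric])

lemma vlip_sum: "(\<And>i. i \<in> I \<Longrightarrow> vlip d (F i)) \<Longrightarrow> vlip d (\<lambda>x. \<Sum>i\<in>I. F i x)"
  by (induction I rule: infinite_finite_induct) (auto intro: vlip_const vlip_add)

lemma vlip_mult:
  assumes F: "vlip d F" and G: "vlip d G" and b: "\<And>x. \<bar>F x\<bar> \<le> B" "\<And>x. \<bar>G x\<bar> \<le> B"
  shows "vlip d (\<lambda>x. F x * G x)"
proof (rule vlip_comp2[OF F G, where K = B and f = "(*)"])
  show "0 \<le> B" using b(1)[of undefined] by linarith
  fix x y
  have "\<bar>F x * G x - F y * G y\<bar> = \<bar>F x * (G x - G y) + G y * (F x - F y)\<bar>" by (simp add: algebra_simps)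
  also have "\<dots> \<le> \<bar>F x\<bar> * \<bar>G x - G y\<bar> + \<bar>G y\<bar> * \<bar>F x - F y\<bar>"
    by (metis abs_mult abs_triangle_ineq)
  also have "\<dots> \<le> B * \<bar>G x - G y\<bar> + B * \<bar>F x - F y\<bar>"
    using b by (intro add_mono mult_right_mono) auto
  finally show "\<bar>F x * G x - F y * G y\<bar> \<le> B * (\<bar>F x - F y\<bar> + \<bar>G x - G y\<bar>)"
    by (simp add: algebra_simps)
qed

text \<open>Both factors of \<open>stopped\<close> are bounded and Lipschitz, which is the purpose
  of the cap and of the gradual weight. The map \<open>T\<close> relabels coordinates to fit the
  vector in an independence statement.\<close>

lemma vlip_stopped:
  assumes a: "0 < a" and g: "\<And>j. j < n \<Longrightarrow> vlip d (\<lambda>z. g j (T z j))"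
  shows "vlip d (\<lambda>z. stopped g a n (T z))"
proof -
  have s: "vlip d (\<lambda>z. psum g i (T z))" if "i \<le> n" for i
    unfolding psum_def using that by (intro vlip_sum g) auto
  have m: "vlip d (\<lambda>z. pmax g i (T z))" if "i \<le> n" for i
    using that by (induction i) (auto intro!: vlip_const vlip_max s)
  show ?thesis
    unfolding stopped_def
  proof (rule vlip_mult)
    show "vlip d (\<lambda>z. min (max 0 (psum g n (T z))) (2 * a))"
      by (intro vlip_min vlip_max vlip_const s) simp
    show "vlip d (\<lambda>z. stop_weight a (pmax g n (T z)))"
      unfolding stop_weight_def
      by (intro vlip_min vlip_max vlip_diff vlip_divide vlip_const m) simp
    show "\<bar>min (max 0 (psum g n (T z))) (2 * a)\<bar> \<le> max 1 (2 * a)" for z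
      using a by auto
    show "\<bar>stop_weight a (pmax g n (T z))\<bar> \<le> max 1 (2 * a)" for z
      using stop_weight_bounds[of a "pmax g n (T z)"] by linarith
  qed
qed

section \<open>One-sided Kolmogorov inequality and its cross terms\<close>

context sublinear_expectation_space
begin

lemma H_stopped:
  assumes "\<And>j. j < n \<Longrightarrow> (\<lambda>\<omega>. g j (X j \<omega>)) \<in> H"
  shows "(\<lambda>\<omega>. stopped g a n (\<lambda>j. X j \<omega>)) \<in> H"
proof -
  have s: "(\<lambda>\<omega>. psum g i (\<lambda>j. X j \<omega>)) \<in> H" if "i \<le> n" for i
    unfolding psum_def using that by (intro H_sum assms) auto
  have m: "(\<lambda>\<omega>. pmax g i (\<lambda>j. X j \<omega>)) \<in> H" if "i \<le> n" for i
    using that by (induction i) (auto intro!: H_zero H_max s)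
  have "(\<lambda>\<omega>. pmax g n (\<lambda>j. X j \<omega>) / a) \<in> H"
    using H_scale[OF m[OF order_refl], of "1 / a"] by simp
  then show ?thesis
    unfolding stopped_def stop_weight_def
    by (intro H_mult H_min H_max H_diff H_const s) simp_all
qed

text \<open>On the event the running maximum reaches \<open>2 * a\<close>, the weight is 0 and the
  potential equals \<open>a^2\<close>, so the pathwise bound divided by \<open>a^2\<close> majorises
  the indicator. Gradual stopping between \<open>a\<close> and \<open>2 * a\<close> costs a factor 4
  against the classical bound.\<close>

lemma Kolmogorov_inequality:
  assumes a: "0 < a" and H: "\<And>j. j < n \<Longrightarrow> (\<lambda>\<omega>. g j (X j \<omega>)) \<in> H"
    and uncorrelated: "\<And>j. j < n \<Longrightarrow> E (\<lambda>\<omega>. stopped g a j (\<lambda>i. X i \<omega>) * g j (X j \<omega>)) \<le> 0"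
  shows "V {\<omega> \<in> space M. \<exists>i\<le>n. 2 * a \<le> psum g i (\<lambda>j. X j \<omega>)}
    \<le> (\<Sum>j<n. E (\<lambda>\<omega>. (g j (X j \<omega>))\<^sup>2)) / a\<^sup>2"
proof -
  define Q where "Q j \<omega> = (g j (X j \<omega>))\<^sup>2 + 2 * (stopped g a j (\<lambda>i. X i \<omega>) * g j (X j \<omega>))" for j \<omega>
  have HQ: "(\<lambda>\<omega>. stopped g a j (\<lambda>i. X i \<omega>) * g j (X j \<omega>)) \<in> H" if "j < n" for j
    using that by (intro H_mult H_stopped H) auto
  have Q: "stop_potential a (psum g n (\<lambda>j. X j \<omega>)) (pmax g n (\<lambda>j. X j \<omega>)) \<le> (\<Sum>j<n. Q j \<omega>)" for \<omega>
    using stop_potential_le[OF a, of g n "\<lambda>j. X j \<omega>"] by (simp add: Q_def mult.assoc)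
  have "V {\<omega> \<in> space M. \<exists>i\<le>n. 2 * a \<le> psum g i (\<lambda>j. X j \<omega>)}
      \<le> E (\<lambda>\<omega>. 1 / a\<^sup>2 * (\<Sum>j<n. Q j \<omega>))"
  proof (rule V_le)
    show "(\<lambda>\<omega>. 1 / a\<^sup>2 * (\<Sum>j<n. Q j \<omega>)) \<in> H"
      unfolding Q_def by (intro H_scale H_sum H_add H_power2 HQ H) auto
    fix \<omega>
    show "indicator {\<omega> \<in> space M. \<exists>i\<le>n. 2 * a \<le> psum g i (\<lambda>j. X j \<omega>)} \<omega> \<le> 1 / a\<^sup>2 * (\<Sum>j<n. Q j \<omega>)"
    proof (cases "\<exists>i\<le>n. 2 * a \<le> psum g i (\<lambda>j. X j \<omega>)")
      case True
      then have "2 * a \<le> pmax g n (\<lambda>j. X j \<omega>)"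
        using psum_le_pmax order_trans by blast
      then have "a\<^sup>2 \<le> (\<Sum>j<n. Q j \<omega>)"
        using Q[of \<omega>] a by (simp add: stop_potential_def stop_weight_eq_0)
      then have "1 \<le> 1 / a\<^sup>2 * (\<Sum>j<n. Q j \<omega>)" using a by (simp add: field_simps)
      moreover have "indicator {\<omega> \<in> space M. \<exists>i\<le>n. 2 * a \<le> psum g i (\<lambda>j. X j \<omega>)} \<omega> \<le> (1::real)"
        by (simp add: indicator_def)
      ultimately show ?thesis by linarith
    next
      case False
      \<comment> \<open>Off the event the majorant only has to be nonnegative, and it dominates the
        nonnegative potential.\<close>
      have "0 \<le> (\<Sum>j<n. Q j \<omega>)" using Q[of \<omega>] stop_potential_nonneg order_trans by blast
      with False show ?thesis by simp
    qed
  qed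
  also have "\<dots> = 1 / a\<^sup>2 * E (\<lambda>\<omega>. \<Sum>j<n. Q j \<omega>)"
    unfolding Q_def by (intro E_pos_hom H_sum H_scale H_add H_power2 HQ H) auto
  also have "\<dots> \<le> 1 / a\<^sup>2 * (\<Sum>j<n. E (\<lambda>\<omega>. (g j (X j \<omega>))\<^sup>2))"
  proof (rule mult_left_mono)
    have "E (\<lambda>\<omega>. \<Sum>j<n. Q j \<omega>) \<le> (\<Sum>j<n. E (Q j))"
      unfolding Q_def by (intro E_sum_le H_add H_scale H_power2 HQ H) auto
    also have "\<dots> \<le> (\<Sum>j<n. E (\<lambda>\<omega>. (g j (X j \<omega>))\<^sup>2))"
    proof (rule sum_mono)
      fix j assume "j \<in> {..<n}"
      then have j: "j < n" by simp
      have "E (Q j) \<le> E (\<lambda>\<omega>. (g j (X j \<omega>))\<^sup>2) + E (\<lambda>\<omega>. 2 * (stopped g a j (\<lambda>i. X i \<omega>) * g j (X j \<omega>)))"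
        unfolding Q_def using j by (intro E_subadd H_scale H_power2 HQ H) auto
      also have "\<dots> \<le> E (\<lambda>\<omega>. (g j (X j \<omega>))\<^sup>2)"
        using uncorrelated[OF j] E_pos_hom[OF HQ[OF j], of 2] by simp
      finally show "E (Q j) \<le> E (\<lambda>\<omega>. (g j (X j \<omega>))\<^sup>2)" .
    qed
    finally show "E (\<lambda>\<omega>. \<Sum>j<n. Q j \<omega>) \<le> (\<Sum>j<n. E (\<lambda>\<omega>. (g j (X j \<omega>))\<^sup>2))" .
  qed simp
  finally show ?thesis by simp
qed

text \<open>Independence freezes the past; \<open>stopped\<close> is then a nonnegative constant,
  which positive homogeneity pulls out of the inner expectation, and the remaining centred
  truncation has expectation 0.\<close>

lemma indep_stopped_uncorrelated:
  fixes J :: "nat set" and c :: real and e :: "nat \<Rightarrow> real"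
  defines "g \<equiv> \<lambda>j t. if j \<in> J then max (- c) (min t c) - e j else 0"
  assumes indep: "indep_of E d (\<lambda>i. X (n + i)) k (\<lambda>i. X (p + i))"
    and d: "1 \<le> d" and J: "J \<inter> {..<n} \<subseteq> {p..<p + k}" and n: "n \<in> J"
    and X: "X n \<in> H" and e: "e n = E (truncate c (X n))" and c: "0 \<le> c" and a: "0 < a"
  shows "E (\<lambda>\<omega>. stopped g a n (\<lambda>i. X i \<omega>) * g n (X n \<omega>)) = 0"
proof -
  \<comment> \<open>Coordinate \<open>j - p\<close> holds \<open>X j\<close> and coordinate
    \<open>k\<close> holds \<open>X n\<close>. For \<open>j < p\<close> the difference is 0, but
    such a \<open>j\<close> below \<open>n\<close> is not in \<open>J\<close>, so \<open>g j\<close>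
    ignores its argument.\<close>
  define \<phi> where "\<phi> z = stopped g a n (\<lambda>j. z (j - p)) * (max (- c) (min (z k) c) - e n)"
    for z :: "nat \<Rightarrow> real"
  have clamp: "\<bar>max (- c) (min t c) - e n\<bar> \<le> c + \<bar>e n\<bar>" for t
    using c by linarith
  have g: "vlip (k + d) (\<lambda>z. g j (z (j - p)))" if "j < n" for j
  proof (cases "j \<in> J")
    case True
    with that J have "j - p < k + d" by fastforce
    then have "vlip (k + d) (\<lambda>z. max (- c) (min (z (j - p)) c) - e j)"
      by (intro vlip_diff vlip_max vlip_min vlip_const vlip_coord)
    with True show ?thesis by (simp add: g_def)
  qed (simp add: g_def vlip_const)
  have "vlip (k + d) \<phi>"
    unfolding \<phi>_def
  proof (rule vlip_mult)
    show "vlip (k + d) (\<lambda>z. stopped g a n (\<lambda>j. z (j - p)))"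
      using vlip_stopped[OF a, where T = "\<lambda>z j. z (j - p)"] g by simp
    show "vlip (k + d) (\<lambda>z. max (- c) (min (z k) c) - e n)"
      using d by (intro vlip_diff vlip_max vlip_min vlip_const vlip_coord) auto
    show "\<bar>stopped g a n (\<lambda>j. x (j - p))\<bar> \<le> 2 * a + c + \<bar>e n\<bar>" for x
      using stopped_nonneg[OF a] stopped_le[OF a, of g n "\<lambda>j. x (j - p)"] c by (simp add: add_increasing2)
    show "\<bar>max (- c) (min (x k) c) - e n\<bar> \<le> 2 * a + c + \<bar>e n\<bar>" for x
      using clamp[of "x k"] a by linarith
  qed
  moreover have "\<bar>\<phi> x\<bar> \<le> 2 * a * (c + \<bar>e n\<bar>)" for x
    unfolding \<phi>_def abs_mult using stopped_nonneg[OF a] stopped_le[OF a, of g n "\<lambda>j. x (j - p)"] clamp a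
    by (intro mult_mono) auto
  ultimately have "\<phi> \<in> C_b_Lip (k + d)"
    unfolding C_b_Lip_def vlip_def by blast
  with indep have *: "E (\<lambda>\<omega>. \<phi> (vappend k (\<lambda>i. X (p + i) \<omega>) (\<lambda>i. X (n + i) \<omega>)))
      = E (\<lambda>\<omega>. E (\<lambda>\<omega>'. \<phi> (vappend k (\<lambda>i. X (p + i) \<omega>) (\<lambda>i. X (n + i) \<omega>'))))"
    unfolding indep_of_def by blast
  have \<phi>: "\<phi> (vappend k (\<lambda>i. X (p + i) \<omega>) (\<lambda>i. X (n + i) \<omega>'))
      = stopped g a n (\<lambda>i. X i \<omega>) * (truncate c (X n) \<omega>' - e n)" for \<omega> \<omega>'
  proof -
    have "stopped g a n (\<lambda>j. vappend k (\<lambda>i. X (p + i) \<omega>) (\<lambda>i. X (n + i) \<omega>') (j - p))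
        = stopped g a n (\<lambda>i. X i \<omega>)"
    proof (rule stopped_cong)
      fix j assume j: "j < n"
      show "g j (vappend k (\<lambda>i. X (p + i) \<omega>) (\<lambda>i. X (n + i) \<omega>') (j - p)) = g j (X j \<omega>)"
      proof (cases "j \<in> J")
        case True
        with j J have "p \<le> j" "j - p < k" by fastforce+
        then show ?thesis by (simp add: vappend_def)
      qed (simp add: g_def)
    qed
    then show ?thesis by (simp add: \<phi>_def truncate_def vappend_def)
  qed
  have "E (\<lambda>\<omega>'. stopped g a n (\<lambda>i. X i \<omega>) * (truncate c (X n) \<omega>' - e n)) = 0" for \<omega>
  proof -
    have "E (\<lambda>\<omega>'. truncate c (X n) \<omega>' - e n) = 0"
      using E_add_const[OF H_truncate[OF X], of c "- e n"] e by simp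
    then show ?thesis
      using E_pos_hom[OF H_diff[OF H_truncate[OF X] H_const] stopped_nonneg[OF a]] by simp
  qed
  then have "E (\<lambda>\<omega>. stopped g a n (\<lambda>i. X i \<omega>) * (truncate c (X n) \<omega> - e n)) = 0"
    using * by (simp add: \<phi> E_zero)
  then show ?thesis using n by (simp add: g_def truncate_def)
qed

end

section \<open>Moments of the truncated summands\<close>

text \<open>A layer-cake bound on a geometric grid: if \<open>\<bar>x\<bar>\<close> exceeds
  \<open>\<beta> ^ k\<close>, the newest layer alone dominates the square; otherwise raising the
  truncation level changes nothing.\<close>

lemma truncate_square_le:
  fixes x \<beta> :: real
  assumes "1 \<le> \<beta>"
  shows "(max (- (\<beta> ^ k)) (min x (\<beta> ^ k)))\<^sup>2 \<le> 1 + (\<Sum>j<k. (\<beta> ^ Suc j)\<^sup>2 * of_bool (\<beta> ^ j < \<bar>x\<bar>))"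
proof (induction k)
  case 0
  have "\<bar>max (- 1) (min x 1)\<bar> \<le> 1" by auto
  then show ?case by (simp add: abs_square_le_1)
next
  case (Suc k)
  have le: "\<beta> ^ k \<le> \<beta> ^ Suc k" using assms by (intro power_increasing) auto
  have pos: "0 \<le> \<beta> ^ k" "0 \<le> \<beta> ^ Suc k" using assms by simp_all
  show ?case
  proof (cases "\<beta> ^ k < \<bar>x\<bar>")
    case False
    then have "max (- (\<beta> ^ Suc k)) (min x (\<beta> ^ Suc k)) = max (- (\<beta> ^ k)) (min x (\<beta> ^ k))"
      using le by linarith
    with Suc False show ?thesis by (simp del: power_Suc)
  next
    case True
    have "\<bar>max (- (\<beta> ^ Suc k)) (min x (\<beta> ^ Suc k))\<bar> \<le> \<bar>\<beta> ^ Suc k\<bar>" using pos by linarith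
    then have "(max (- (\<beta> ^ Suc k)) (min x (\<beta> ^ Suc k)))\<^sup>2 \<le> (\<beta> ^ Suc k)\<^sup>2"
      by (rule abs_le_square_iff[THEN iffD1])
    moreover have "0 \<le> (\<Sum>j<k. (\<beta> ^ Suc j)\<^sup>2 * of_bool (\<beta> ^ j < \<bar>x\<bar>))"
      by (intro sum_nonneg) simp
    ultimately show ?thesis using True by (simp del: power_Suc)
  qed
qed

text \<open>The same layering for first powers: the two truncations differ by at most the excess
  over \<open>\<beta> ^ k\<close> of \<open>\<bar>x\<bar>\<close> capped at the top level.\<close>

lemma truncate_diff_le:
  fixes x \<beta> d :: real
  assumes \<beta>: "1 \<le> \<beta>" and d: "\<beta> ^ k \<le> d" "d \<le> \<beta> ^ (k + l)"
  shows "\<bar>max (- d) (min x d) - max (- (\<beta> ^ k)) (min x (\<beta> ^ k))\<bar>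
    \<le> (\<Sum>j<l. \<beta> ^ Suc (k + j) * of_bool (\<beta> ^ (k + j) < \<bar>x\<bar>))"
proof -
  have nn: "0 \<le> (\<Sum>j<l. \<beta> ^ Suc (k + j) * of_bool (\<beta> ^ (k + j) < \<bar>x\<bar>))" for l
    using \<beta> by (intro sum_nonneg) simp
  have 1: "min \<bar>x\<bar> (\<beta> ^ (k + l)) - \<beta> ^ k \<le> (\<Sum>j<l. \<beta> ^ Suc (k + j) * of_bool (\<beta> ^ (k + j) < \<bar>x\<bar>))" for l
  proof (induction l)
    case (Suc l)
    have pos: "0 \<le> \<beta> ^ k" using \<beta> by simp
    have le: "\<beta> ^ (k + l) \<le> \<beta> ^ (k + Suc l)" using \<beta> by (intro power_increasing) auto
    show ?case
    proof (cases "\<beta> ^ (k + l) < \<bar>x\<bar>")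
      case False
      then have "min \<bar>x\<bar> (\<beta> ^ (k + Suc l)) = min \<bar>x\<bar> (\<beta> ^ (k + l))" using le by linarith
      with Suc False show ?thesis by simp
    next
      case True
      have "min \<bar>x\<bar> (\<beta> ^ (k + Suc l)) - \<beta> ^ k \<le> \<beta> ^ Suc (k + l)"
        using pos by (simp add: min.coboundedI2)
      with True nn[of l] show ?thesis by simp
    qed
  qed simp
  have "\<bar>max (- d) (min x d) - max (- (\<beta> ^ k)) (min x (\<beta> ^ k))\<bar> \<le> max 0 (min \<bar>x\<bar> (\<beta> ^ (k + l)) - \<beta> ^ k)"
  proof -
    have "0 \<le> \<beta> ^ k" using \<beta> by simp
    with d show ?thesis by (simp add: min_def max_def abs_if)
  qed
  with 1[of l] nn[of l] show ?thesis by linarith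
qed

lemma tail_suminf_tendsto_0:
  fixes f :: "nat \<Rightarrow> real"
  assumes "summable f"
  shows "(\<lambda>k. \<Sum>j. f (k + j)) \<longlonglongrightarrow> 0"
proof -
  have "(\<lambda>k. (\<Sum>j. f j) - (\<Sum>j<k. f j)) \<longlonglongrightarrow> (\<Sum>j. f j) - (\<Sum>j. f j)"
    by (intro tendsto_intros summable_LIMSEQ assms)
  moreover have "(\<Sum>j. f (k + j)) = (\<Sum>j. f j) - (\<Sum>j<k. f j)" for k
    using suminf_minus_initial_segment[OF assms, of k] by (simp add: add.commute)
  ultimately show ?thesis by simp
qed

context sublinear_expectation_space
begin

lemma E_truncate_square_le:
  assumes X: "X \<in> H" and \<beta>: "1 \<le> \<beta>"
  shows "E (\<lambda>\<omega>. (truncate (\<beta> ^ k) X \<omega>)\<^sup>2)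
    \<le> 1 + (\<Sum>j<k. (\<beta> ^ Suc j)\<^sup>2 * V {\<omega> \<in> space M. \<beta> ^ j < \<bar>X \<omega>\<bar>})"
proof (rule E_le_sum_V)
  fix \<omega> assume "\<omega> \<in> space M"
  then have "indicator {\<omega> \<in> space M. \<beta> ^ j < \<bar>X \<omega>\<bar>} \<omega> = (of_bool (\<beta> ^ j < \<bar>X \<omega>\<bar>) :: real)" for j
    by (simp add: indicator_def)
  with truncate_square_le[OF \<beta>, of k "X \<omega>"]
  show "(truncate (\<beta> ^ k) X \<omega>)\<^sup>2
      \<le> 1 + (\<Sum>j<k. (\<beta> ^ Suc j)\<^sup>2 * indicator {\<omega> \<in> space M. \<beta> ^ j < \<bar>X \<omega>\<bar>} \<omega>)"
    by (simp add: truncate_def del: power_Suc)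
qed (use X in \<open>auto intro!: H_power2 H_truncate\<close>)

text \<open>For each \<open>d\<close> finitely many layers suffice; replacing them by the whole
  series makes the bound uniform in \<open>d\<close>.\<close>

lemma E_truncate_diff_le:
  assumes X: "X \<in> H" and \<beta>: "1 < \<beta>" and d: "\<beta> ^ k \<le> d"
    and s: "summable (\<lambda>j. \<beta> ^ Suc j * V {\<omega> \<in> space M. \<beta> ^ j < \<bar>X \<omega>\<bar>})"
  shows "\<bar>E (truncate d X) - E (truncate (\<beta> ^ k) X)\<bar>
    \<le> (\<Sum>j. \<beta> ^ Suc (k + j) * V {\<omega> \<in> space M. \<beta> ^ (k + j) < \<bar>X \<omega>\<bar>})"
proof -
  obtain l where "d < \<beta> ^ l" using real_arch_pow[OF \<beta>] by blast
  moreover have "\<beta> ^ l \<le> \<beta> ^ (k + l)" using \<beta> by (intro power_increasing) auto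
  ultimately have l: "d \<le> \<beta> ^ (k + l)" by linarith
  have "\<bar>E (truncate d X) - E (truncate (\<beta> ^ k) X)\<bar> \<le> E (\<lambda>\<omega>. \<bar>truncate d X \<omega> - truncate (\<beta> ^ k) X \<omega>\<bar>)"
    by (intro E_abs_diff_le H_truncate X)
  also have "\<dots> \<le> 0 + (\<Sum>j<l. \<beta> ^ Suc (k + j) * V {\<omega> \<in> space M. \<beta> ^ (k + j) < \<bar>X \<omega>\<bar>})"
  proof (rule E_le_sum_V)
    fix \<omega> assume "\<omega> \<in> space M"
    then have "indicator {\<omega> \<in> space M. \<beta> ^ (k + j) < \<bar>X \<omega>\<bar>} \<omega> = (of_bool (\<beta> ^ (k + j) < \<bar>X \<omega>\<bar>) :: real)" for j
      by (simp add: indicator_def)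
    with truncate_diff_le[OF less_imp_le[OF \<beta>] d l, of "X \<omega>"]
    show "\<bar>truncate d X \<omega> - truncate (\<beta> ^ k) X \<omega>\<bar>
        \<le> 0 + (\<Sum>j<l. \<beta> ^ Suc (k + j) * indicator {\<omega> \<in> space M. \<beta> ^ (k + j) < \<bar>X \<omega>\<bar>} \<omega>)"
      by (simp add: truncate_def del: power_Suc)
  qed (use X \<beta> in \<open>auto intro!: H_abs H_diff H_truncate\<close>)
  also have "\<dots> \<le> (\<Sum>j. \<beta> ^ Suc (k + j) * V {\<omega> \<in> space M. \<beta> ^ (k + j) < \<bar>X \<omega>\<bar>})"
  proof -
    have "summable (\<lambda>j. \<beta> ^ Suc (k + j) * V {\<omega> \<in> space M. \<beta> ^ (k + j) < \<bar>X \<omega>\<bar>})"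
      using summable_ignore_initial_segment[OF s, of k] by (simp add: add.commute)
    then show ?thesis unfolding add_0 using \<beta> by (intro sum_le_suminf) (auto intro!: mult_nonneg_nonneg V_nonneg)
  qed
  finally show ?thesis .
qed

text \<open>The uniform tail bound makes the truncated expectations Cauchy, first along
  \<open>\<beta> ^ k\<close> and then for all levels, so the limit behind \<open>E_breve\<close>
  exists and inherits the bound.\<close>

lemma E_truncate_breve_le:
  assumes X: "X \<in> H" and \<beta>: "1 < \<beta>"
    and s: "summable (\<lambda>j. \<beta> ^ Suc j * V {\<omega> \<in> space M. \<beta> ^ j < \<bar>X \<omega>\<bar>})"
  shows "\<bar>E (truncate (\<beta> ^ k) X) - E_breve E X\<bar>
    \<le> (\<Sum>j. \<beta> ^ Suc (k + j) * V {\<omega> \<in> space M. \<beta> ^ (k + j) < \<bar>X \<omega>\<bar>})"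
proof -
  define T where "T k = (\<Sum>j. \<beta> ^ Suc (k + j) * V {\<omega> \<in> space M. \<beta> ^ (k + j) < \<bar>X \<omega>\<bar>})" for k
  define F where "F d = E (truncate d X)" for d
  have T: "T \<longlonglongrightarrow> 0"
    using tail_suminf_tendsto_0[OF s] by (simp add: T_def[abs_def])
  have F: "\<bar>F d - F (\<beta> ^ k)\<bar> \<le> T k" if "\<beta> ^ k \<le> d" for d k
    unfolding F_def T_def by (rule E_truncate_diff_le[OF X \<beta> that s])
  have "Cauchy (\<lambda>k. F (\<beta> ^ k))"
  proof (rule metric_CauchyI)
    fix e :: real assume "0 < e"
    then have "eventually (\<lambda>k. T k < e / 2) sequentially"
      using T by (intro order_tendstoD(2)) auto
    then obtain K where K: "T K < e / 2" by (auto simp: eventually_sequentially)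
    have "dist (F (\<beta> ^ m)) (F (\<beta> ^ n)) < e" if "m \<ge> K" "n \<ge> K" for m n
    proof -
      have "\<bar>F (\<beta> ^ m) - F (\<beta> ^ K)\<bar> \<le> T K" "\<bar>F (\<beta> ^ n) - F (\<beta> ^ K)\<bar> \<le> T K"
        using that \<beta> by (auto intro!: F power_increasing)
      with K show ?thesis by (simp add: dist_real_def)
    qed
    then show "\<exists>K. \<forall>m\<ge>K. \<forall>n\<ge>K. dist (F (\<beta> ^ m)) (F (\<beta> ^ n)) < e" by blast
  qed
  then obtain L where L: "(\<lambda>k. F (\<beta> ^ k)) \<longlonglongrightarrow> L"
    using Cauchy_convergent convergent_def by blast
  have FL: "\<bar>L - F (\<beta> ^ k)\<bar> \<le> T k" for k
  proof (rule tendsto_upperbound)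
    show "(\<lambda>n. \<bar>F (\<beta> ^ n) - F (\<beta> ^ k)\<bar>) \<longlonglongrightarrow> \<bar>L - F (\<beta> ^ k)\<bar>"
      by (intro tendsto_intros L)
    show "\<forall>\<^sub>F n in sequentially. \<bar>F (\<beta> ^ n) - F (\<beta> ^ k)\<bar> \<le> T k"
      using eventually_ge_at_top[of k]
      by eventually_elim (use \<beta> in \<open>auto intro!: F power_increasing\<close>)
  qed simp
  have "(F \<longlongrightarrow> L) at_top"
  proof (rule tendstoI)
    fix e :: real assume "0 < e"
    then have "eventually (\<lambda>k. T k < e / 2) sequentially"
      using T by (intro order_tendstoD(2)) auto
    then obtain K where K: "T K < e / 2" by (auto simp: eventually_sequentially)
    show "\<forall>\<^sub>F d in at_top. dist (F d) L < e"
      using eventually_ge_at_top[of "\<beta> ^ K"]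
    proof eventually_elim
      case (elim d)
      from F[OF this] FL[of K] K show ?case by (simp add: dist_real_def)
    qed
  qed
  \<comment> \<open>Convergence having been shown, the definite description \<open>Lim\<close>
    yields the limit.\<close>
  then have "E_breve E X = L"
    unfolding E_breve_def F_def by (intro tendsto_Lim) auto
  with FL[of k] show ?thesis by (simp add: F_def T_def abs_minus_commute)
qed

end

section \<open>Sequences dominated on average by \<open>Z\<close>\<close>

abbreviation dyadic :: "nat \<Rightarrow> nat set" where
  "dyadic k \<equiv> {2 ^ k..<2 ^ Suc k}"

text \<open>The exponent enters only through \<open>\<beta>\<close>, later
  \<open>2 powr (1 / r)\<close>: \<open>r \<ge> 1\<close> becomes \<open>\<beta> \<le> 2\<close>,
  and \<open>r < 2\<close> becomes \<open>2 < \<beta>\<^sup>2\<close>. Multiplying the average by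
  \<open>n\<close> lets \<open>n = 0\<close> be included.\<close>

locale dominated_sequence = sublinear_expectation_space +
  fixes X :: "nat \<Rightarrow> 'a \<Rightarrow> real" and Z :: "'a \<Rightarrow> real" and C \<beta> :: real
  assumes X_H: "\<And>n. 1 \<le> n \<Longrightarrow> X n \<in> H"
    and C_nonneg: "0 \<le> C"
    and dom: "\<And>n t. 0 < t \<Longrightarrow> (\<Sum>k=1..n. V {\<omega> \<in> space M. t < \<bar>X k \<omega>\<bar>})
      \<le> C * real n * V {\<omega> \<in> space M. t < \<bar>Z \<omega>\<bar>}"
    and \<beta>_pos: "0 < \<beta>" and \<beta>_le: "\<beta> \<le> 2" and \<beta>_sq: "2 < \<beta>\<^sup>2"
    and Z_summable: "summable (\<lambda>j. 2 ^ j * V {\<omega> \<in> space M. \<beta> ^ j < \<bar>Z \<omega>\<bar>})"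
begin

lemma \<beta>_gt_1: "1 < \<beta>"
proof (rule ccontr)
  assume "\<not> 1 < \<beta>"
  then have "\<beta>\<^sup>2 \<le> 1\<^sup>2" using \<beta>_pos by (intro power_mono) auto
  with \<beta>_sq show False by simp
qed

abbreviation VX :: "nat \<Rightarrow> nat \<Rightarrow> real" where
  "VX n j \<equiv> V {\<omega> \<in> space M. \<beta> ^ j < \<bar>X n \<omega>\<bar>}"

abbreviation VZ :: "nat \<Rightarrow> real" where
  "VZ j \<equiv> V {\<omega> \<in> space M. \<beta> ^ j < \<bar>Z \<omega>\<bar>}"

lemma dyadic_ge_1: "n \<in> dyadic k \<Longrightarrow> 1 \<le> n"
  by (metis One_nat_def Suc_leI atLeastLessThan_iff less_le_trans pos2 zero_less_power)

text \<open>Domination concerns averages over initial segments, so the interval is enlarged to all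
  indices up to \<open>2 ^ Suc k\<close>.\<close>

lemma sum_VX_dyadic_le: "(\<Sum>n\<in>dyadic k. VX n j) \<le> C * 2 ^ Suc k * VZ j"
proof -
  have "(\<Sum>n\<in>dyadic k. VX n j) \<le> (\<Sum>n=1..2 ^ Suc k. VX n j)"
    by (intro sum_mono2) (auto intro: V_nonneg dest: dyadic_ge_1)
  also have "\<dots> \<le> C * real (2 ^ Suc k) * VZ j"
    using \<beta>_pos by (intro dom) simp
  finally show ?thesis by simp
qed

text \<open>A single tail is dominated up to a factor \<open>n\<close>; for fixed \<open>n\<close>
  this is enough for the series that makes \<open>E_breve\<close> of \<open>X n\<close>
  meaningful.\<close>

lemma VX_le: "1 \<le> n \<Longrightarrow> VX n j \<le> C * real n * VZ j"
proof -
  assume "1 \<le> n"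
  then have "VX n j \<le> (\<Sum>i=1..n. VX i j)"
    by (intro member_le_sum) (auto intro: V_nonneg)
  also have "\<dots> \<le> C * real n * VZ j"
    using \<beta>_pos by (intro dom) simp
  finally show ?thesis .
qed

lemma \<beta>_power_le: "\<beta> ^ j \<le> 2 ^ j"
  using \<beta>_pos \<beta>_le by (intro power_mono) auto

lemma summable_VZ: "summable (\<lambda>j. \<beta> ^ Suc j * VZ j)"
proof (rule summable_comparison_test')
  show "summable (\<lambda>j. \<beta> * (2 ^ j * VZ j))" by (intro summable_mult Z_summable)
  show "norm (\<beta> ^ Suc j * VZ j) \<le> \<beta> * (2 ^ j * VZ j)" for j
    using \<beta>_pos mult_left_mono[OF mult_right_mono[OF \<beta>_power_le[of j] V_nonneg], of \<beta> "{\<omega> \<in> space M. \<beta> ^ j < \<bar>Z \<omega>\<bar>}"]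
    by (simp add: V_nonneg mult.assoc)
qed

lemma summable_VX: "1 \<le> n \<Longrightarrow> summable (\<lambda>j. \<beta> ^ Suc j * VX n j)"
proof (rule summable_comparison_test')
  assume n: "1 \<le> n"
  show "summable (\<lambda>j. C * real n * (\<beta> ^ Suc j * VZ j))" by (intro summable_mult summable_VZ)
  show "norm (\<beta> ^ Suc j * VX n j) \<le> C * real n * (\<beta> ^ Suc j * VZ j)" for j
    using \<beta>_pos mult_left_mono[OF VX_le[OF n, of j], of "\<beta> ^ Suc j"]
    by (simp add: V_nonneg algebra_simps)
qed

lemma summable_dyadic_exceed: "summable (\<lambda>k. \<Sum>n\<in>dyadic k. VX n k)"
proof (rule summable_comparison_test')
  show "summable (\<lambda>k. 2 * C * (2 ^ k * VZ k))" by (intro summable_mult Z_summable)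
  show "norm (\<Sum>n\<in>dyadic k. VX n k) \<le> 2 * C * (2 ^ k * VZ k)" for k
    using sum_VX_dyadic_le[of k k] by (simp add: sum_nonneg V_nonneg mult.assoc mult.left_commute)
qed

lemma summable_dyadic_variance:
  "summable (\<lambda>k. (\<Sum>n\<in>dyadic k. E (\<lambda>\<omega>. (truncate (\<beta> ^ k) (X n) \<omega>)\<^sup>2)) / (\<beta> ^ k)\<^sup>2)"
proof -
  \<comment> \<open>From one level to the next the number of indices doubles while the squared
    truncation level grows by \<open>\<beta>^2\<close>; \<open>q\<close> is the ratio.\<close>
  define q where "q = 2 / \<beta>\<^sup>2"
  have q: "0 < q" "q < 1" using \<beta>_sq \<beta>_pos by (auto simp: q_def)
  \<comment> \<open>The tail at level \<open>j\<close> contributes to interval \<open>k\<close> with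
    the damping \<open>q ^ (k - j)\<close>, so the total is a Cauchy product with a geometric
    series.\<close>
  define A where "A k = (\<Sum>j\<le>k. (2 ^ j * VZ j) * q ^ (k - j))" for k
  have sA: "summable A"
    unfolding A_def
  proof (rule summable_Cauchy_product)
    show "summable (\<lambda>j. norm (2 ^ j * VZ j))" using Z_summable by (simp add: V_nonneg)
    show "summable (\<lambda>j. norm (q ^ j))" using q by (simp add: summable_geometric)
  qed
  \<comment> \<open>The separate term \<open>q ^ k\<close> stems from the constant 1 in the
    second-moment bound, summed over \<open>2 ^ k\<close> indices.\<close>
  have "summable (\<lambda>k. q ^ k + 2 * C * \<beta>\<^sup>2 * A k)"
    using q by (intro summable_add summable_mult sA summable_geometric) auto
  then show ?thesis
  proof (rule summable_comparison_test'[where N = 0])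
    fix k
    have Hn: "X n \<in> H" if "n \<in> dyadic k" for n using that dyadic_ge_1 X_H by blast
    have "(\<Sum>n\<in>dyadic k. E (\<lambda>\<omega>. (truncate (\<beta> ^ k) (X n) \<omega>)\<^sup>2))
        \<le> (\<Sum>n\<in>dyadic k. 1 + (\<Sum>j<k. (\<beta> ^ Suc j)\<^sup>2 * VX n j))"
      using \<beta>_gt_1 by (intro sum_mono E_truncate_square_le Hn) auto
    also have "\<dots> = 2 ^ k + (\<Sum>j<k. (\<beta> ^ Suc j)\<^sup>2 * (\<Sum>n\<in>dyadic k. VX n j))"
      by (simp add: sum.distrib sum.swap[of _ "{..<k}"] sum_distrib_left del: power_Suc) (simp)
    also have "\<dots> \<le> 2 ^ k + (\<Sum>j<k. (\<beta> ^ Suc j)\<^sup>2 * (C * 2 ^ Suc k * VZ j))"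
      by (intro add_left_mono sum_mono mult_left_mono sum_VX_dyadic_le) simp
    also have "\<dots> = (q ^ k + 2 * C * \<beta>\<^sup>2 * (\<Sum>j<k. (2 ^ j * VZ j) * q ^ (k - j))) * (\<beta> ^ k)\<^sup>2"
    proof -
      have qk: "q ^ k * (\<beta> ^ k)\<^sup>2 = 2 ^ k"
        using \<beta>_pos by (simp add: q_def power_divide power_mult[symmetric] mult.commute)
      have "(\<beta> ^ Suc j)\<^sup>2 * (C * 2 ^ Suc k * VZ j)
          = 2 * C * \<beta>\<^sup>2 * ((2 ^ j * VZ j) * q ^ (k - j)) * (\<beta> ^ k)\<^sup>2" if "j < k" for j
      proof -
        have "2 ^ j * q ^ (k - j) * (\<beta> ^ k)\<^sup>2 = (\<beta> ^ j)\<^sup>2 * (q ^ j * q ^ (k - j)) * (\<beta> ^ k)\<^sup>2"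
          using \<beta>_pos by (simp add: q_def power_divide power_mult[symmetric] mult.commute)
        also have "\<dots> = (\<beta> ^ j)\<^sup>2 * 2 ^ k"
          using that qk by (simp add: power_add[symmetric] mult.assoc)
        finally have *: "2 ^ j * q ^ (k - j) * (\<beta> ^ k)\<^sup>2 = (\<beta> ^ j)\<^sup>2 * 2 ^ k" .
        have "2 * C * \<beta>\<^sup>2 * ((2 ^ j * VZ j) * q ^ (k - j)) * (\<beta> ^ k)\<^sup>2
            = 2 * C * \<beta>\<^sup>2 * VZ j * (2 ^ j * q ^ (k - j) * (\<beta> ^ k)\<^sup>2)"
          by (simp add: mult_ac)
        also have "\<dots> = (\<beta> ^ Suc j)\<^sup>2 * (C * 2 ^ Suc k * VZ j)"
          unfolding * by (simp add: power_mult_distrib mult_ac)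
        finally show ?thesis by (rule sym)
      qed
      then have "(\<Sum>j<k. (\<beta> ^ Suc j)\<^sup>2 * (C * 2 ^ Suc k * VZ j))
          = (\<Sum>j<k. 2 * C * \<beta>\<^sup>2 * ((2 ^ j * VZ j) * q ^ (k - j)) * (\<beta> ^ k)\<^sup>2)"
        by (intro sum.cong) auto
      also have "\<dots> = 2 * C * \<beta>\<^sup>2 * (\<Sum>j<k. (2 ^ j * VZ j) * q ^ (k - j)) * (\<beta> ^ k)\<^sup>2"
        by (simp add: sum_distrib_left sum_distrib_right)
      finally show ?thesis using qk by (simp add: distrib_right)
    qed
    \<comment> \<open>The nonnegative term \<open>j = k\<close> is added to complete the Cauchy
      product.\<close>
    also have "\<dots> \<le> (q ^ k + 2 * C * \<beta>\<^sup>2 * A k) * (\<beta> ^ k)\<^sup>2"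
      unfolding A_def using C_nonneg q
      by (intro mult_right_mono add_left_mono mult_left_mono sum_mono2) (auto intro!: mult_nonneg_nonneg V_nonneg)
    finally have "(\<Sum>n\<in>dyadic k. E (\<lambda>\<omega>. (truncate (\<beta> ^ k) (X n) \<omega>)\<^sup>2)) / (\<beta> ^ k)\<^sup>2 \<le> q ^ k + 2 * C * \<beta>\<^sup>2 * A k"
      using \<beta>_pos by (simp add: divide_le_eq)
    moreover have "0 \<le> (\<Sum>n\<in>dyadic k. E (\<lambda>\<omega>. (truncate (\<beta> ^ k) (X n) \<omega>)\<^sup>2))"
      by (intro sum_nonneg E_nonneg H_power2 H_truncate Hn) simp_all
    ultimately show "norm ((\<Sum>n\<in>dyadic k. E (\<lambda>\<omega>. (truncate (\<beta> ^ k) (X n) \<omega>)\<^sup>2)) / (\<beta> ^ k)\<^sup>2)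
        \<le> q ^ k + 2 * C * \<beta>\<^sup>2 * A k"
      by simp
  qed
qed

text \<open>Domination leaves terms of order \<open>\<beta> ^ j * 2 ^ k * VZ (k + j)\<close> after
  division by \<open>\<beta> ^ k\<close>. Since \<open>\<beta> ^ j \<le> 2 ^ j\<close>, they are
  bounded by a tail of the convergent series for \<open>Z\<close>.\<close>

lemma dyadic_bias_tendsto_0:
  "(\<lambda>k. (\<Sum>n\<in>dyadic k. \<bar>E (truncate (\<beta> ^ k) (X n)) - E_breve E (X n)\<bar>) / \<beta> ^ k) \<longlonglongrightarrow> 0"
proof (rule tendsto_sandwich)
  show "\<forall>\<^sub>F k in sequentially. 0 \<le> (\<Sum>n\<in>dyadic k. \<bar>E (truncate (\<beta> ^ k) (X n)) - E_breve E (X n)\<bar>) / \<beta> ^ k"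
    using \<beta>_pos by (simp add: sum_nonneg)
  show "\<forall>\<^sub>F k in sequentially. (\<Sum>n\<in>dyadic k. \<bar>E (truncate (\<beta> ^ k) (X n)) - E_breve E (X n)\<bar>) / \<beta> ^ k
      \<le> 2 * C * \<beta> * (\<Sum>j. 2 ^ (k + j) * VZ (k + j))"
  proof (intro always_eventually allI)
    fix k
    have sX: "summable (\<lambda>j. \<beta> ^ Suc (k + j) * VX n (k + j))" if "n \<in> dyadic k" for n
      using summable_ignore_initial_segment[OF summable_VX[OF dyadic_ge_1[OF that]], of k]
      by (simp add: add.commute)
    have sZ: "summable (\<lambda>j. 2 ^ (k + j) * VZ (k + j))"
      using summable_ignore_initial_segment[OF Z_summable, of k] by (simp add: add.commute)
    have "(\<Sum>n\<in>dyadic k. \<bar>E (truncate (\<beta> ^ k) (X n)) - E_breve E (X n)\<bar>)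
        \<le> (\<Sum>n\<in>dyadic k. \<Sum>j. \<beta> ^ Suc (k + j) * VX n (k + j))"
      by (rule sum_mono, rule E_truncate_breve_le[OF X_H[OF dyadic_ge_1] \<beta>_gt_1 summable_VX[OF dyadic_ge_1]])
    also have "\<dots> = (\<Sum>j. \<Sum>n\<in>dyadic k. \<beta> ^ Suc (k + j) * VX n (k + j))"
      using sX by (intro suminf_sum[symmetric])
    also have "\<dots> \<le> (\<Sum>j. 2 * C * \<beta> * (2 ^ (k + j) * VZ (k + j)) * \<beta> ^ k)"
    proof (rule suminf_le)
      show "summable (\<lambda>j. \<Sum>n\<in>dyadic k. \<beta> ^ Suc (k + j) * VX n (k + j))"
        using sX by (intro summable_sum)
      show "summable (\<lambda>j. 2 * C * \<beta> * (2 ^ (k + j) * VZ (k + j)) * \<beta> ^ k)"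
        by (intro summable_mult summable_mult2 sZ)
      fix j
      have "(\<Sum>n\<in>dyadic k. \<beta> ^ Suc (k + j) * VX n (k + j)) \<le> \<beta> ^ Suc (k + j) * (C * 2 ^ Suc k * VZ (k + j))"
        unfolding sum_distrib_left[symmetric] using \<beta>_pos by (intro mult_left_mono sum_VX_dyadic_le) simp
      also have "\<dots> = 2 * C * \<beta> * (\<beta> ^ j * (2 ^ k * VZ (k + j))) * \<beta> ^ k"
        by (simp add: power_add mult_ac)
      also have "\<dots> \<le> 2 * C * \<beta> * (2 ^ j * (2 ^ k * VZ (k + j))) * \<beta> ^ k"
        using \<beta>_pos C_nonneg by (intro mult_right_mono mult_left_mono \<beta>_power_le) (auto simp: V_nonneg)
      finally show "(\<Sum>n\<in>dyadic k. \<beta> ^ Suc (k + j) * VX n (k + j)) \<le> 2 * C * \<beta> * (2 ^ (k + j) * VZ (k + j)) * \<beta> ^ k"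
        by (simp add: power_add mult_ac)
    qed
    also have "\<dots> = 2 * C * \<beta> * (\<Sum>j. 2 ^ (k + j) * VZ (k + j)) * \<beta> ^ k"
      using sZ by (simp add: suminf_mult suminf_mult2[symmetric] summable_mult)
    finally show "(\<Sum>n\<in>dyadic k. \<bar>E (truncate (\<beta> ^ k) (X n)) - E_breve E (X n)\<bar>) / \<beta> ^ k
        \<le> 2 * C * \<beta> * (\<Sum>j. 2 ^ (k + j) * VZ (k + j))"
      using \<beta>_pos by (simp add: divide_le_eq)
  qed
next
  have "(\<lambda>k. 2 * C * \<beta> * (\<Sum>j. 2 ^ (k + j) * VZ (k + j))) \<longlonglongrightarrow> 2 * C * \<beta> * 0"
    by (intro tendsto_mult_left tail_suminf_tendsto_0[OF Z_summable])
  then show "(\<lambda>k. 2 * C * \<beta> * (\<Sum>j. 2 ^ (k + j) * VZ (k + j))) \<longlonglongrightarrow> 0" by simp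
qed simp

end

section \<open>Blocks and residue classes\<close>

text \<open>The blocks concerned have distinct left ends below \<open>2 ^ (k + 1)\<close>.
  Finiteness ensures that \<open>card\<close> is a genuine count and not its default 0.\<close>

lemma I_blocks_finite:
  assumes N: "strict_mono_on {1..} N"
  shows "finite (I_blocks N k)"
proof (rule finite_imageD)
  have "N ` I_blocks N k \<subseteq> {..<2 ^ (k + 1)}" by (auto simp: I_blocks_def)
  then show "finite (N ` I_blocks N k)" by (rule finite_subset) simp
  show "inj_on N (I_blocks N k)"
    by (rule inj_on_subset[OF strict_mono_on_imp_inj_on[OF N]]) (auto simp: I_blocks_def)
qed

lemma block_unique:
  fixes N :: "nat \<Rightarrow> nat"
  assumes N: "strict_mono_on {1..} N"
    and "1 \<le> i" "N i \<le> n" "n < N (i + 1)" and "1 \<le> i'" "N i' \<le> n" "n < N (i' + 1)"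
  shows "i = i'"
proof -
  have *: "\<not> i < i'" if "1 \<le> i" "n < N (i + 1)" "N i' \<le> n" for i i'
  proof
    assume "i < i'"
    then have "N (i + 1) \<le> N i'"
      using that by (intro strict_mono_on_leD[OF N]) auto
    with that show False by simp
  qed
  from *[of i i'] *[of i' i] assms show ?thesis by auto
qed

lemma block_exists:
  fixes N :: "nat \<Rightarrow> nat"
  assumes N: "strict_mono_on {1..} N" and n: "N 1 \<le> n"
  obtains i where "1 \<le> i" "N i \<le> n" "n < N (i + 1)"
proof -
  have ge: "i \<le> N (Suc i)" for i
  proof (induction i)
    case (Suc i)
    have "N (Suc i) < N (Suc (Suc i))" by (rule strict_mono_onD[OF N]) auto
    with Suc show ?case by simp
  qed simp
  have "n < N (Suc (Suc n))" using ge[of "Suc n"] by simp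
  then have ex: "\<exists>i. n < N (Suc i)" by blast
  define i where "i = (LEAST i. n < N (Suc i))"
  have i: "n < N (Suc i)" unfolding i_def by (rule LeastI_ex[OF ex])
  \<comment> \<open>Blocks are numbered from 1 and \<open>N 0\<close> is arbitrary; index 0 would
    mean \<open>n < N 1\<close>.\<close>
  have "i \<noteq> 0" using i n by (cases i) auto
  moreover have "N i \<le> n"
  proof (rule ccontr)
    assume "\<not> N i \<le> n"
    with \<open>i \<noteq> 0\<close> have "n < N (Suc (i - 1))" by simp
    then have "i \<le> i - 1" unfolding i_def by (rule Least_le)
    with \<open>i \<noteq> 0\<close> show False by simp
  qed
  ultimately show thesis using that[of i] i by simp
qed

text \<open>The induction step amounts to \<open>4 \<le> 3 * \<beta>\<close>; the rational 4/3 lies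
  below the square root of 2.\<close>

lemma sum_powers_le:
  fixes \<beta> :: real
  assumes "4 / 3 \<le> \<beta>"
  shows "(\<Sum>j\<le>k. \<beta> ^ j) \<le> 4 * \<beta> ^ k"
proof (induction k)
  case (Suc k)
  have "4 * \<beta> ^ k \<le> (3 * \<beta>) * \<beta> ^ k" using assms by (intro mult_right_mono) auto
  with Suc show ?case by simp
qed simp

text \<open>\<open>w\<close> stands for the normalisation \<open>n powr (1 / r)\<close>, of which
  only the lower bound on each dyadic interval is recorded.\<close>

locale blockwise_dominated_sequence = dominated_sequence +
  fixes N :: "nat \<Rightarrow> nat" and m :: nat and w :: "nat \<Rightarrow> real"
  assumes N_mono: "strict_mono_on {1..} N"
    and dep: "blockwise_m_dependent E m N X"
    and w: "\<And>k n. n \<in> dyadic k \<Longrightarrow> \<beta> ^ k \<le> w n"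
begin

section \<open>Residue classes inside the blocks of a dyadic interval\<close>

definition J :: "nat \<Rightarrow> nat \<times> nat \<Rightarrow> nat set" where
  "J k q = {n \<in> dyadic k. N (fst q) \<le> n \<and> n < N (fst q + 1) \<and> n mod (m + 1) = snd q}"

definition Q :: "nat \<Rightarrow> (nat \<times> nat) set" where
  "Q k = I_blocks N k \<times> {..m}"

definition e :: "nat \<Rightarrow> nat \<Rightarrow> real" where
  "e k n = E (truncate (\<beta> ^ k) (X n))"

definition g :: "nat \<Rightarrow> nat \<times> nat \<Rightarrow> nat \<Rightarrow> real \<Rightarrow> real" where
  "g k q j t = (if j \<in> J k q then max (- (\<beta> ^ k)) (min t (\<beta> ^ k)) - e k j else 0)"

lemma finite_Q: "finite (Q k)"
  by (simp add: Q_def I_blocks_finite[OF N_mono])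

lemma card_Q: "card (Q k) = v_blocks N k * (m + 1)"
  by (simp add: Q_def v_blocks_def card_cartesian_product)

lemma J_dyadic: "J k q \<subseteq> dyadic k"
  by (auto simp: J_def)

lemma finite_J: "finite (J k q)"
  by (rule finite_subset[OF J_dyadic]) simp

lemma J_disjoint:
  assumes "q \<in> Q k" "q' \<in> Q k" "q \<noteq> q'"
  shows "J k q \<inter> J k q' = {}"
proof (rule ccontr)
  assume "J k q \<inter> J k q' \<noteq> {}"
  then obtain n where n: "n \<in> J k q" "n \<in> J k q'" by blast
  have "fst q = fst q'"
    by (rule block_unique[OF N_mono, of _ n]) (use n assms in \<open>auto simp: J_def Q_def I_blocks_def\<close>)
  moreover have "snd q = snd q'" using n by (auto simp: J_def)
  ultimately show False using assms(3) by (simp add: prod_eq_iff)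
qed

text \<open>Indices below \<open>N 1\<close> lie in no block, hence the restriction on
  \<open>k\<close>.\<close>

lemma J_cover:
  assumes k: "N 1 \<le> 2 ^ k"
  shows "(\<Union>q\<in>Q k. J k q) = dyadic k"
proof (rule antisym)
  show "dyadic k \<subseteq> (\<Union>q\<in>Q k. J k q)"
  proof
    fix n assume n: "n \<in> dyadic k"
    then have "N 1 \<le> n" using k by simp
    then obtain i where i: "1 \<le> i" "N i \<le> n" "n < N (i + 1)" by (rule block_exists[OF N_mono])
    have "i \<in> I_blocks N k" using n i by (auto simp: I_blocks_def)
    moreover have "n mod (m + 1) \<le> m" by (metis Suc_eq_plus1 less_Suc_eq_le mod_less_divisor zero_less_Suc)
    ultimately have "(i, n mod (m + 1)) \<in> Q k" by (simp add: Q_def)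
    moreover have "n \<in> J k (i, n mod (m + 1))" using n i by (simp add: J_def)
    ultimately show "n \<in> (\<Union>q\<in>Q k. J k q)" by blast
  qed
qed (use J_dyadic in blast)

text \<open>Either \<open>n\<close> is outside the class or has no predecessor in it, and a factor
  vanishes; or all predecessors lie at least \<open>m + 1\<close> behind \<open>n\<close>, and
  \<open>m\<close>-dependence of the block applies.\<close>

lemma uncorrelated:
  assumes q: "q \<in> Q k" and a: "0 < a"
  shows "E (\<lambda>\<omega>. stopped (g k q) a n (\<lambda>i. X i \<omega>) * g k q n (X n \<omega>)) = 0"
proof (cases "n \<in> J k q \<and> (\<exists>i<n. i \<in> J k q)")
  case False
  have *: "stopped (g k q) a n x * g k q n y = 0" for x y
  proof (cases "n \<in> J k q")
    case True
    with False have "psum (g k q) n x = 0" by (auto simp: psum_def g_def intro: sum.neutral)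
    then show ?thesis using a by (simp add: stopped_def)
  qed (simp add: g_def)
  show ?thesis unfolding * by (rule E_zero)
next
  case True
  then obtain i where i: "i < n" "i \<in> J k q" and n: "n \<in> J k q" by blast
  define p where "p = N (fst q)"
  have gap: "i' + m + 1 \<le> n" if "i' < n" "i' \<in> J k q" for i'
  proof -
    have "i' mod (m + 1) = n mod (m + 1)" using that n by (simp add: J_def)
    then have "m + 1 dvd n - i'" using that(1) by (metis mod_eq_dvd_iff_nat less_imp_le)
    then have "m + 1 \<le> n - i'" using that(1) by (intro dvd_imp_le) auto
    with that(1) show ?thesis by simp
  qed
  have p: "p \<le> i" "n < N (fst q + 1)" using i n by (auto simp: J_def p_def)
  have "m_dependent_block E m X p (N (fst q + 1))"
    using dep q unfolding blockwise_m_dependent_def p_def by (auto simp: Q_def I_blocks_def)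
  \<comment> \<open>The past ends at \<open>n - (m + 1)\<close>, so its distance to \<open>n\<close>
    is just above \<open>m\<close>. Two members of the class in one block make the block longer than
    \<open>m + 1\<close>, which excludes the first alternative of
    \<open>m_dependent_block\<close>.\<close>
  moreover have "p \<le> n - m - 1" "n - m - 1 < n" "n - (n - m - 1) > m" "\<not> N (fst q + 1) - p \<le> m + 1"
    using gap[OF i] p by linarith+
  ultimately have "indep_of E (N (fst q + 1) - n) (\<lambda>i. X (n + i)) (n - m - 1 - p + 1) (\<lambda>i. X (p + i))"
    using p(2) unfolding m_dependent_block_def by blast
  moreover have "J k q \<inter> {..<n} \<subseteq> {p..<p + (n - m - 1 - p + 1)}"
  proof
    fix i' assume "i' \<in> J k q \<inter> {..<n}"
    then have "p \<le> i'" "i' + m + 1 \<le> n" using gap by (auto simp: J_def p_def)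
    then show "i' \<in> {p..<p + (n - m - 1 - p + 1)}" by simp
  qed
  moreover have "X n \<in> H" using n J_dyadic dyadic_ge_1 by (intro X_H) blast
  ultimately show ?thesis
    unfolding g_def using p(2) a \<beta>_pos n by (intro indep_stopped_uncorrelated) (auto simp: e_def)
qed

lemma H_J: "n \<in> J k q \<Longrightarrow> X n \<in> H"
  using J_dyadic dyadic_ge_1 by (intro X_H) blast

text \<open>Letting \<open>i\<close> run up to \<open>2 ^ Suc k\<close> covers a prefix ending
  anywhere in the interval; indices off the class contribute 0. The factor 4 is the price of
  centring.\<close>

lemma class_maximal_inequality:
  assumes q: "q \<in> Q k" and a: "0 < a"
  shows "V {\<omega> \<in> space M. \<exists>i\<le>2 ^ Suc k. 2 * a \<le> psum (g k q) i (\<lambda>j. X j \<omega>)}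
    \<le> 4 / a\<^sup>2 * (\<Sum>n\<in>J k q. E (\<lambda>\<omega>. (truncate (\<beta> ^ k) (X n) \<omega>)\<^sup>2))"
proof -
  have g: "(\<lambda>\<omega>. g k q j (X j \<omega>)) = (if j \<in> J k q then (\<lambda>\<omega>. truncate (\<beta> ^ k) (X j) \<omega> - e k j) else (\<lambda>_. 0))" for j
    by (simp add: g_def truncate_def)
  have "V {\<omega> \<in> space M. \<exists>i\<le>2 ^ Suc k. 2 * a \<le> psum (g k q) i (\<lambda>j. X j \<omega>)}
      \<le> (\<Sum>j<2 ^ Suc k. E (\<lambda>\<omega>. (g k q j (X j \<omega>))\<^sup>2)) / a\<^sup>2"
  proof (rule Kolmogorov_inequality[OF a])
    show "(\<lambda>\<omega>. g k q j (X j \<omega>)) \<in> H" for j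
      unfolding g by (auto intro!: H_zero H_diff H_truncate H_const H_J)
  qed (use uncorrelated[OF q a] in simp)
  also have "(\<Sum>j<2 ^ Suc k. E (\<lambda>\<omega>. (g k q j (X j \<omega>))\<^sup>2)) = (\<Sum>j\<in>J k q. E (\<lambda>\<omega>. (g k q j (X j \<omega>))\<^sup>2))"
    using J_dyadic[of k q] by (intro sum.mono_neutral_right) (auto simp: g_def E_zero)
  also have "\<dots> \<le> (\<Sum>j\<in>J k q. 4 * E (\<lambda>\<omega>. (truncate (\<beta> ^ k) (X j) \<omega>)\<^sup>2))"
  proof (rule sum_mono)
    fix j assume j: "j \<in> J k q"
    show "E (\<lambda>\<omega>. (g k q j (X j \<omega>))\<^sup>2) \<le> 4 * E (\<lambda>\<omega>. (truncate (\<beta> ^ k) (X j) \<omega>)\<^sup>2)"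
      using E_centered_square_le[OF H_truncate[OF H_J[OF j]], of "\<beta> ^ k"] j
      by (simp add: g_def e_def truncate_def)
  qed
  finally show ?thesis
    using a by (simp add: sum_distrib_left[symmetric] divide_right_mono)
qed

section \<open>Exceptional events of a dyadic interval\<close>

definition D :: "real \<Rightarrow> nat \<Rightarrow> 'a set" where
  "D \<epsilon> k = (\<Union>n\<in>dyadic k. {\<omega> \<in> space M. \<beta> ^ k < \<bar>X n \<omega>\<bar>})
    \<union> (\<Union>q\<in>Q k. {\<omega> \<in> space M. \<exists>i\<le>2 ^ Suc k. 2 * (\<epsilon> * \<beta> ^ k) \<le> psum (g k q) i (\<lambda>j. X j \<omega>)})"

lemma D_sets: "D \<epsilon> k \<in> sets M"
  unfolding D_def
proof (intro sets.Un sets.finite_UN finite_Q finite_atLeastLessThan)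
  fix n assume "n \<in> dyadic k"
  then have [measurable]: "X n \<in> borel_measurable M" using X_H dyadic_ge_1 H_measurable by blast
  show "{\<omega> \<in> space M. \<beta> ^ k < \<bar>X n \<omega>\<bar>} \<in> sets M" by measurable
next
  fix q
  have "(\<lambda>\<omega>. g k q j (X j \<omega>)) \<in> borel_measurable M" for j
  proof (cases "j \<in> J k q")
    case True
    then have [measurable]: "X j \<in> borel_measurable M" using H_J H_measurable by blast
    from True show ?thesis unfolding g_def by simp
  qed (simp add: g_def)
  then have [measurable]: "(\<lambda>\<omega>. psum (g k q) i (\<lambda>j. X j \<omega>)) \<in> borel_measurable M" for i
    unfolding psum_def by (intro borel_measurable_sum)
  show "{\<omega> \<in> space M. \<exists>i\<le>2 ^ Suc k. 2 * (\<epsilon> * \<beta> ^ k) \<le> psum (g k q) i (\<lambda>j. X j \<omega>)} \<in> sets M"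
    by measurable
qed

text \<open>The classes are disjoint subsets of the interval, so their second moments add up to at
  most those of the interval, however many classes there are.\<close>

lemma summable_V_D:
  assumes \<epsilon>: "0 < \<epsilon>"
  shows "summable (\<lambda>k. V (D \<epsilon> k))"
proof (rule summable_comparison_test')
  define W where "W k = (\<Sum>n\<in>dyadic k. E (\<lambda>\<omega>. (truncate (\<beta> ^ k) (X n) \<omega>)\<^sup>2))" for k
  show "summable (\<lambda>k. (\<Sum>n\<in>dyadic k. VX n k) + 4 / \<epsilon>\<^sup>2 * (W k / (\<beta> ^ k)\<^sup>2))"
    unfolding W_def by (intro summable_add summable_mult summable_dyadic_exceed summable_dyadic_variance)
  fix k
  define a where "a = \<epsilon> * \<beta> ^ k"
  have a: "0 < a" using \<epsilon> \<beta>_pos by (simp add: a_def)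
  have "V (D \<epsilon> k) \<le> V (\<Union>n\<in>dyadic k. {\<omega> \<in> space M. \<beta> ^ k < \<bar>X n \<omega>\<bar>})
      + V (\<Union>q\<in>Q k. {\<omega> \<in> space M. \<exists>i\<le>2 ^ Suc k. 2 * a \<le> psum (g k q) i (\<lambda>j. X j \<omega>)})"
    unfolding D_def a_def by (rule V_Un_le)
  also have "\<dots> \<le> (\<Sum>n\<in>dyadic k. VX n k)
      + (\<Sum>q\<in>Q k. V {\<omega> \<in> space M. \<exists>i\<le>2 ^ Suc k. 2 * a \<le> psum (g k q) i (\<lambda>j. X j \<omega>)})"
    by (intro add_mono V_UN_le finite_Q finite_atLeastLessThan)
  also have "\<dots> \<le> (\<Sum>n\<in>dyadic k. VX n k)
      + (\<Sum>q\<in>Q k. 4 / a\<^sup>2 * (\<Sum>n\<in>J k q. E (\<lambda>\<omega>. (truncate (\<beta> ^ k) (X n) \<omega>)\<^sup>2)))"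
    by (intro add_left_mono sum_mono class_maximal_inequality a)
  also have "\<dots> = (\<Sum>n\<in>dyadic k. VX n k)
      + 4 / a\<^sup>2 * (\<Sum>n\<in>(\<Union>q\<in>Q k. J k q). E (\<lambda>\<omega>. (truncate (\<beta> ^ k) (X n) \<omega>)\<^sup>2))"
    by (subst sum.UNION_disjoint)
      (use finite_Q finite_J J_disjoint in \<open>auto simp: sum_distrib_left\<close>)
  also have "\<dots> \<le> (\<Sum>n\<in>dyadic k. VX n k) + 4 / a\<^sup>2 * W k"
    unfolding W_def
    by (intro add_left_mono mult_left_mono sum_mono2 E_nonneg H_power2 H_truncate X_H dyadic_ge_1[of _ k])
      (use J_dyadic in auto)
  also have "4 / a\<^sup>2 * W k = 4 / \<epsilon>\<^sup>2 * (W k / (\<beta> ^ k)\<^sup>2)"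
    by (simp add: a_def power_mult_distrib)
  finally show "norm (V (D \<epsilon> k)) \<le> (\<Sum>n\<in>dyadic k. VX n k) + 4 / \<epsilon>\<^sup>2 * (W k / (\<beta> ^ k)\<^sup>2)"
    by (simp add: V_nonneg)
qed

definition bias :: "nat \<Rightarrow> real" where
  "bias k = (\<Sum>n\<in>dyadic k. \<bar>e k n - E_breve E (X n)\<bar>)"

text \<open>Off \<open>D\<close> every summand equals its truncation and every class contributes at
  most \<open>2 * (\<epsilon> * \<beta> ^ k)\<close>; the number of classes is
  \<open>v_blocks N k * (m + 1)\<close>.\<close>

lemma dyadic_partial_sum_le:
  assumes \<omega>: "\<omega> \<in> space M" "\<omega> \<notin> D \<epsilon> k" and k: "N 1 \<le> 2 ^ k" and n: "n \<in> dyadic k"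
  shows "(\<Sum>j\<in>{2 ^ k..<Suc n}. X j \<omega> - E_breve E (X j))
    \<le> 2 * real (m + 1) * real (v_blocks N k) * (\<epsilon> * \<beta> ^ k) + bias k"
proof -
  define y where "y j = truncate (\<beta> ^ k) (X j) \<omega> - e k j" for j
  have sub: "{2 ^ k..<Suc n} \<subseteq> dyadic k" using n by auto
  have "X j \<omega> - E_breve E (X j) = y j + (e k j - E_breve E (X j))" if "j \<in> dyadic k" for j
  proof -
    have "\<bar>X j \<omega>\<bar> \<le> \<beta> ^ k" using \<omega> that by (auto simp: D_def not_less)
    then have "truncate (\<beta> ^ k) (X j) \<omega> = X j \<omega>" by (auto simp: truncate_def)
    then show ?thesis by (simp add: y_def)
  qed
  then have "(\<Sum>j\<in>{2 ^ k..<Suc n}. X j \<omega> - E_breve E (X j))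
      = (\<Sum>j\<in>{2 ^ k..<Suc n}. y j) + (\<Sum>j\<in>{2 ^ k..<Suc n}. e k j - E_breve E (X j))"
    unfolding sum.distrib[symmetric] using sub by (intro sum.cong) blast+
  moreover have "(\<Sum>j\<in>{2 ^ k..<Suc n}. e k j - E_breve E (X j)) \<le> bias k"
  proof -
    have "(\<Sum>j\<in>{2 ^ k..<Suc n}. e k j - E_breve E (X j)) \<le> (\<Sum>j\<in>{2 ^ k..<Suc n}. \<bar>e k j - E_breve E (X j)\<bar>)"
      by (intro sum_mono) simp
    also have "\<dots> \<le> bias k" unfolding bias_def using sub by (intro sum_mono2) auto
    finally show ?thesis .
  qed
  moreover have "(\<Sum>j\<in>{2 ^ k..<Suc n}. y j) \<le> 2 * real (m + 1) * real (v_blocks N k) * (\<epsilon> * \<beta> ^ k)"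
  proof -
    have "{2 ^ k..<Suc n} = (\<Union>q\<in>Q k. J k q) \<inter> {..<Suc n}"
      unfolding J_cover[OF k] using n by auto
    also have "\<dots> = (\<Union>q\<in>Q k. J k q \<inter> {..<Suc n})" by blast
    finally have "(\<Sum>j\<in>{2 ^ k..<Suc n}. y j) = (\<Sum>j\<in>(\<Union>q\<in>Q k. J k q \<inter> {..<Suc n}). y j)" by simp
    also have "\<dots> = (\<Sum>q\<in>Q k. \<Sum>j\<in>J k q \<inter> {..<Suc n}. y j)"
      using finite_Q finite_J J_disjoint by (intro sum.UNION_disjoint) blast+
    also have "\<dots> = (\<Sum>q\<in>Q k. psum (g k q) (Suc n) (\<lambda>j. X j \<omega>))"
    proof (intro sum.cong refl)
      fix q
      have "psum (g k q) (Suc n) (\<lambda>j. X j \<omega>) = (\<Sum>j\<in>J k q \<inter> {..<Suc n}. g k q j (X j \<omega>))"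
        unfolding psum_def by (intro sum.mono_neutral_right) (auto simp: g_def)
      also have "\<dots> = (\<Sum>j\<in>J k q \<inter> {..<Suc n}. y j)"
        by (intro sum.cong) (auto simp: g_def y_def truncate_def)
      finally show "(\<Sum>j\<in>J k q \<inter> {..<Suc n}. y j) = psum (g k q) (Suc n) (\<lambda>j. X j \<omega>)" by simp
    qed
    also have "\<dots> \<le> (\<Sum>q\<in>Q k. 2 * (\<epsilon> * \<beta> ^ k))"
    proof (rule sum_mono)
      fix q assume "q \<in> Q k"
      then have "\<not> (\<exists>i\<le>2 ^ Suc k. 2 * (\<epsilon> * \<beta> ^ k) \<le> psum (g k q) i (\<lambda>j. X j \<omega>))"
        using \<omega> unfolding D_def by blast
      \<comment> \<open>\<open>psum\<close> up to \<open>Suc n\<close> includes the index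
        \<open>n\<close>; the last index of the interval attains the bound
        \<open>2 ^ Suc k\<close>.\<close>
      moreover have "Suc n \<le> 2 ^ Suc k" using n by simp
      ultimately show "psum (g k q) (Suc n) (\<lambda>j. X j \<omega>) \<le> 2 * (\<epsilon> * \<beta> ^ k)"
        by (meson linear)
    qed
    also have "\<dots> = 2 * real (m + 1) * real (v_blocks N k) * (\<epsilon> * \<beta> ^ k)"
      by (simp add: card_Q algebra_simps)
    finally show ?thesis .
  qed
  ultimately show ?thesis by linarith
qed

lemma v_blocks_le_Phi:
  assumes "n \<in> dyadic k" "j \<le> k"
  shows "v_blocks N j \<le> Phi_blocks N n"
proof -
  have "Phi_blocks N n = (MAX j\<in>{0..k}. v_blocks N j)"
    using assms(1) by (intro Phi_blocks_dyadic) simp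
  then show ?thesis using assms(2) by simp
qed

text \<open>Makes \<open>Phi_blocks\<close> at least 1 for large indices, so the final division is
  proper.\<close>

lemma v_blocks_pos:
  assumes "N 1 \<le> 2 ^ k"
  shows "1 \<le> v_blocks N k"
proof -
  obtain i where i: "1 \<le> i" "N i \<le> 2 ^ k" "2 ^ k < N (i + 1)" by (rule block_exists[OF N_mono assms])
  then have "2 ^ k \<in> {2 ^ k..<2 ^ (k + 1)} \<inter> {N i..<N (i + 1)}" by simp
  with i(1) have "i \<in> I_blocks N k" unfolding I_blocks_def by blast
  then show ?thesis
    unfolding v_blocks_def using I_blocks_finite[OF N_mono, of k] by (metis One_nat_def Suc_leI card_gt_0_iff empty_iff)
qed

text \<open>The dyadic estimates are chained from \<open>K\<close> on, the last interval possibly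
  incomplete; everything before \<open>2 ^ K\<close> stays in a remainder that does not depend on
  \<open>n\<close>.\<close>

lemma centered_sum_le:
  fixes \<omega> :: 'a and K :: nat
  defines "U \<equiv> \<lambda>n. \<Sum>j\<in>{1..<Suc n}. X j \<omega> - E_breve E (X j)"
  assumes \<omega>: "\<omega> \<in> space M" "\<And>k. K \<le> k \<Longrightarrow> \<omega> \<notin> D \<epsilon> k" and K: "N 1 \<le> 2 ^ K"
    and bias: "\<And>k. K \<le> k \<Longrightarrow> bias k \<le> \<epsilon> * \<beta> ^ k"
    and k: "K \<le> k" and n: "n \<in> dyadic k"
  shows "U n \<le> U (2 ^ K - 1) + (\<Sum>j\<in>{K..k}. (2 * real (m + 1) * real (v_blocks N j) + 1) * (\<epsilon> * \<beta> ^ j))"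
proof -
  have block_step: "U n \<le> U (2 ^ k - 1) + (2 * real (m + 1) * real (v_blocks N k) + 1) * (\<epsilon> * \<beta> ^ k)"
    if "K \<le> k" "n \<in> dyadic k" for n k
  proof -
    have "(2::nat) ^ K \<le> 2 ^ k" using that(1) by (intro power_increasing) auto
    with K have Nk: "N 1 \<le> 2 ^ k" by linarith
    have "U n = U (2 ^ k - 1) + (\<Sum>j\<in>{2 ^ k..<Suc n}. X j \<omega> - E_breve E (X j))"
      unfolding U_def using that(2) by (simp add: sum.atLeastLessThan_concat)
    with dyadic_partial_sum_le[OF \<omega>(1) \<omega>(2)[OF that(1)] Nk that(2)] bias[OF that(1)]
    show ?thesis by (simp add: distrib_right)
  qed
  from k n show ?thesis
  proof (induction k arbitrary: n rule: dec_induct)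
    case base
    then show ?case using block_step[of K n] by simp
  next
    case (step k)
    \<comment> \<open>This is the last index of interval \<open>k\<close>, where the next interval
      takes over.\<close>
    have "(2::nat) ^ Suc k - 1 \<in> dyadic k" by auto
    from step.IH[OF this] block_step[of "Suc k" n] step.hyps step.prems
    show ?case by simp
  qed
qed

end

section \<open>The strong law\<close>

text \<open>Cauchy condensation: the level-set capacity decreases in \<open>t\<close>, hence is at
  least \<open>v j\<close> on \<open>A j\<close>. The intervals \<open>A j\<close> are disjoint with
  length \<open>2 ^ j / 2\<close>, and the power \<open>r\<close> maps the level
  \<open>(2 powr (1 / r)) ^ j\<close> to \<open>2 ^ j\<close>.\<close>

lemma summable_choquet_levels:
  assumes sp: "sublinear_expectation_space M H E"
    and r: "0 < r" and fin: "choquet M H E (\<lambda>\<omega>. \<bar>Z \<omega>\<bar> powr r) < \<infinity>"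
  shows "summable (\<lambda>j. 2 ^ j * V_hat M H E {\<omega> \<in> space M. (2 powr (1 / r)) ^ j < \<bar>Z \<omega>\<bar>})"
proof -
  interpret sublinear_expectation_space M H E by (rule sp)
  define v where "v j = V {\<omega> \<in> space M. (2 powr (1 / r)) ^ j < \<bar>Z \<omega>\<bar>}" for j :: nat
  define h where "h t = V {\<omega> \<in> space M. t \<le> \<bar>Z \<omega>\<bar> powr r}" for t
  define A where "A j = {2 ^ j / 2<..(2::real) ^ j}" for j :: nat
  \<comment> \<open>For \<open>t \<le> 0\<close> the level set is the whole space. The negative part
    being 0, finiteness of the difference passes to the first integral.\<close>
  have "(\<integral>\<^sup>+ t\<in>{..0}. ennreal (1 - h t) \<partial>lborel) = (\<integral>\<^sup>+ t. 0 \<partial>(lborel :: real measure))"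
  proof (intro nn_integral_cong)
    fix t :: real
    have "h t = 1" if "t \<le> 0"
    proof -
      have "t \<le> \<bar>Z \<omega>\<bar> powr r" for \<omega> using that powr_ge_zero order_trans by blast
      then have "{\<omega> \<in> space M. t \<le> \<bar>Z \<omega>\<bar> powr r} = space M" by blast
      then show ?thesis unfolding h_def by (simp add: V_space)
    qed
    then show "ennreal (1 - h t) * indicator {..0} t = 0" by (cases "t \<le> 0") simp_all
  qed
  then have second_0: "enn2ereal (\<integral>\<^sup>+ t\<in>{..0}. ennreal (1 - h t) \<partial>lborel) = 0"
    by (simp only: nn_integral_const mult_zero_left zero_ennreal.rep_eq)
  have "choquet M H E (\<lambda>\<omega>. \<bar>Z \<omega>\<bar> powr r) = enn2ereal (\<integral>\<^sup>+ t\<in>{0..}. ennreal (h t) \<partial>lborel)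
      - enn2ereal (\<integral>\<^sup>+ t\<in>{..0}. ennreal (1 - h t) \<partial>lborel)"
    unfolding choquet_def h_def ..
  with fin have "enn2ereal (\<integral>\<^sup>+ t\<in>{0..}. ennreal (h t) \<partial>lborel) < \<infinity>"
    by (simp only: second_0 ereal_minus)
  then have fin': "(\<integral>\<^sup>+ t\<in>{0..}. ennreal (h t) \<partial>lborel) < top"
    by (simp only: less_ennreal.rep_eq top_ennreal.rep_eq top_ereal_def)
  have vh: "v j \<le> h t" if "t \<in> A j" for j t
    unfolding v_def h_def
  proof (rule V_mono)
    fix \<omega> assume \<omega>: "\<omega> \<in> space M" "\<omega> \<in> {\<omega> \<in> space M. (2 powr (1 / r)) ^ j < \<bar>Z \<omega>\<bar>}"
    have "t \<le> 2 ^ j" using that by (simp add: A_def)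
    also have "(2::real) ^ j = ((2 powr (1 / r)) ^ j) powr r"
      using r by (simp add: powr_realpow[symmetric] powr_powr)
    also have "\<dots> \<le> \<bar>Z \<omega>\<bar> powr r" using \<omega> r by (intro powr_mono2) auto
    finally show "\<omega> \<in> {\<omega> \<in> space M. t \<le> \<bar>Z \<omega>\<bar> powr r}" using \<omega>(1) by simp
  qed
  have A_unique: "i = j" if "t \<in> A i" "t \<in> A j" for i j t
  proof -
    have *: "\<not> i < j" if "t \<in> A i" "t \<in> A j" for i j
    proof
      assume "i < j"
      then have "(2::real) ^ Suc i \<le> 2 ^ j" by (intro power_increasing) auto
      with that show False by (simp add: A_def)
    qed
    from *[of i j] *[of j i] that show ?thesis by auto
  qed
  have "(\<Sum>j. ennreal (2 ^ j * v j / 2)) = (\<Sum>j. \<integral>\<^sup>+ t. ennreal (v j) * indicator (A j) t \<partial>lborel)"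
  proof (rule arg_cong[where f = suminf], rule ext)
    fix j
    have "(\<integral>\<^sup>+ t. ennreal (v j) * indicator (A j) t \<partial>lborel) = ennreal (v j) * ennreal (2 ^ j - 2 ^ j / 2)"
      unfolding A_def by (subst nn_integral_cmult_indicator) simp_all
    also have "\<dots> = ennreal (2 ^ j * v j / 2)"
      using V_nonneg by (simp add: ennreal_mult[symmetric] v_def mult.commute)
    finally show "ennreal (2 ^ j * v j / 2) = (\<integral>\<^sup>+ t. ennreal (v j) * indicator (A j) t \<partial>lborel)" by simp
  qed
  also have "\<dots> = (\<integral>\<^sup>+ t. (\<Sum>j. ennreal (v j) * indicator (A j) t) \<partial>lborel)"
    unfolding A_def by (intro nn_integral_suminf[symmetric]) measurable
  also have "\<dots> \<le> (\<integral>\<^sup>+ t\<in>{0..}. ennreal (h t) \<partial>lborel)"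
  proof (rule nn_integral_mono)
    fix t :: real
    show "(\<Sum>j. ennreal (v j) * indicator (A j) t) \<le> ennreal (h t) * indicator {0..} t"
    proof (cases "\<exists>j. t \<in> A j")
      case True
      then obtain j where j: "t \<in> A j" by blast
      have "0 \<le> (2::real) ^ j / 2" by simp
      with j have t: "0 \<le> t" unfolding A_def by (auto intro: less_imp_le order_trans)
      have "(\<Sum>i. ennreal (v i) * indicator (A i) t) = (\<Sum>i\<in>{j}. ennreal (v i) * indicator (A i) t)"
        using A_unique[OF j] by (intro suminf_finite) (auto simp: indicator_def)
      also have "\<dots> \<le> ennreal (h t) * indicator {0..} t"
        using j t vh[OF j] by (simp add: ennreal_leI)
      finally show ?thesis .
    next
      case False
      then have "indicator (A j) t = (0::ennreal)" for j by simp
      then show ?thesis by simp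
    qed
  qed
  finally have "(\<Sum>j. ennreal (2 ^ j * v j / 2)) \<noteq> top" using fin' by auto
  then have "summable (\<lambda>j. 2 ^ j * v j / 2)"
    by (intro summable_suminf_not_top) (auto simp: v_def V_nonneg)
  from summable_mult[OF this, of 2] show ?thesis by (simp add: v_def)
qed

section \<open>Limit superior of the normalised sums\<close>

context blockwise_dominated_sequence
begin

definition ratio :: "nat \<Rightarrow> 'a \<Rightarrow> real" where
  "ratio n \<omega> = ((\<Sum>k=1..n. X k \<omega>) - (\<Sum>k=1..n. E_breve E (X k))) / (w n * real (Phi_blocks N n))"

text \<open>The constant is \<open>4 * (2 * (m + 1) + 1) + 1\<close>: the interval estimate times
  the geometric factor 4 for summing the levels, plus 1 for the initial remainder.\<close>

lemma limsup_ratio_le: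
  assumes \<epsilon>: "0 < \<epsilon>" and \<omega>: "\<omega> \<in> space M" "\<And>k. K0 \<le> k \<Longrightarrow> \<omega> \<notin> D \<epsilon> k"
  shows "limsup (\<lambda>n. ereal (ratio n \<omega>)) \<le> ereal ((8 * real (m + 1) + 5) * \<epsilon>)"
proof (rule Limsup_bounded)
  have "eventually (\<lambda>k. bias k / \<beta> ^ k < \<epsilon>) sequentially"
    using \<epsilon> dyadic_bias_tendsto_0 unfolding bias_def e_def by (intro order_tendstoD(2)) auto
  then obtain K1 where K1: "\<And>k. K1 \<le> k \<Longrightarrow> bias k / \<beta> ^ k < \<epsilon>" by (auto simp: eventually_sequentially)
  \<comment> \<open>Past \<open>K\<close> three things hold: blocks cover the interval (as
    \<open>N 1 < 2 ^ N 1\<close>), \<open>\<omega>\<close> avoids \<open>D\<close>, and the bias is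
    below \<open>\<epsilon> * \<beta> ^ k\<close>.\<close>
  define K where "K = max (N 1) (max K0 K1)"
  have "N 1 < 2 ^ N 1" by (rule less_exp)
  also have "(2::nat) ^ N 1 \<le> 2 ^ K" by (intro power_increasing) (auto simp: K_def)
  finally have K: "N 1 \<le> 2 ^ K" by simp
  have bias: "bias k \<le> \<epsilon> * \<beta> ^ k" if "K \<le> k" for k
    using K1[of k] that \<beta>_pos by (simp add: K_def divide_less_eq less_imp_le)
  have \<omega>D: "\<omega> \<notin> D \<epsilon> k" if "K \<le> k" for k
    using that by (intro \<omega>(2)) (simp add: K_def)
  define U where "U n = (\<Sum>j\<in>{1..<Suc n}. X j \<omega> - E_breve E (X j))" for n
  define U0 where "U0 = \<bar>U (2 ^ K - 1)\<bar>"
  \<comment> \<open>From level \<open>K2\<close> on, the fixed initial remainder is at most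
    \<open>\<epsilon> * \<beta> ^ k\<close>.\<close>
  obtain K2 where K2: "U0 / \<epsilon> < \<beta> ^ K2" using real_arch_pow[OF \<beta>_gt_1] by blast
  have \<beta>43: "4 / 3 \<le> \<beta>"
  proof (rule ccontr)
    assume "\<not> 4 / 3 \<le> \<beta>"
    then have "\<beta>\<^sup>2 \<le> (4 / 3)\<^sup>2" using \<beta>_pos by (intro power_mono) auto
    with \<beta>_sq show False by (simp add: power2_eq_square)
  qed
  show "\<forall>\<^sub>F n in sequentially. ereal (ratio n \<omega>) \<le> ereal ((8 * real (m + 1) + 5) * \<epsilon>)"
    using eventually_ge_at_top[of "2 ^ max K K2"]
  proof eventually_elim
    case (elim n)
    define k where "k = floor_log n"
    have "0 < n" using elim by (metis gr0I le_zero_eq power_not_zero zero_neq_numeral)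
    then have n: "n \<in> dyadic k"
      unfolding k_def using floor_log_exp2_le[of n] floor_log_exp2_gt[of n] by simp
    have "(2::nat) ^ max K K2 < 2 ^ Suc k" using elim n by simp
    then have k: "K \<le> k" "K2 \<le> k" by (auto simp: power_strict_increasing_iff simp del: power_Suc)
    define p where "p = real (Phi_blocks N n)"
    have "(2::nat) ^ K \<le> 2 ^ k" using k by (intro power_increasing) auto
    with K have "N 1 \<le> 2 ^ k" by linarith
    then have p: "1 \<le> p"
      unfolding p_def using v_blocks_pos v_blocks_le_Phi[OF n order_refl]
      by (metis of_nat_1 of_nat_mono order_trans)
    have "U n \<le> U (2 ^ K - 1) + (\<Sum>j\<in>{K..k}. (2 * real (m + 1) * real (v_blocks N j) + 1) * (\<epsilon> * \<beta> ^ j))"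
      unfolding U_def by (rule centered_sum_le[OF \<omega>(1) \<omega>D K bias k(1) n])
    also have "\<dots> \<le> U0 + (\<Sum>j\<in>{K..k}. (2 * real (m + 1) * p + p) * (\<epsilon> * \<beta> ^ j))"
    proof (intro add_mono sum_mono mult_right_mono mult_left_mono)
      fix j assume "j \<in> {K..k}"
      then show "real (v_blocks N j) \<le> p" unfolding p_def using v_blocks_le_Phi[OF n] by simp
    qed (use p \<epsilon> \<beta>_pos in \<open>auto simp: U0_def\<close>)
    also have "\<dots> \<le> U0 + (\<Sum>j\<le>k. (2 * real (m + 1) * p + p) * (\<epsilon> * \<beta> ^ j))"
      using p \<epsilon> \<beta>_pos by (intro add_left_mono sum_mono2) auto
    also have "\<dots> = U0 + (2 * real (m + 1) + 1) * p * \<epsilon> * (\<Sum>j\<le>k. \<beta> ^ j)"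
      unfolding sum_distrib_left by (intro arg_cong2[where f = "(+)"] sum.cong refl) (simp add: algebra_simps)
    also have "\<dots> \<le> \<epsilon> * \<beta> ^ k * p + (2 * real (m + 1) + 1) * p * \<epsilon> * (4 * \<beta> ^ k)"
    proof (intro add_mono mult_left_mono sum_powers_le \<beta>43)
      have "U0 \<le> \<epsilon> * \<beta> ^ K2" using K2 \<epsilon> by (simp add: field_simps)
      also have "\<dots> \<le> \<epsilon> * \<beta> ^ k * 1"
        using \<epsilon> \<beta>_gt_1 k by (auto intro!: mult_left_mono power_increasing)
      also have "\<dots> \<le> \<epsilon> * \<beta> ^ k * p" using p \<epsilon> \<beta>_pos by (intro mult_left_mono) auto
      finally show "U0 \<le> \<epsilon> * \<beta> ^ k * p" .
    qed (use p \<epsilon> in auto)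
    also have "\<dots> = (8 * real (m + 1) + 5) * \<epsilon> * (\<beta> ^ k * p)"
      by (simp add: algebra_simps)
    also have "\<dots> \<le> (8 * real (m + 1) + 5) * \<epsilon> * (w n * p)"
      using w[OF n] p \<epsilon> by (intro mult_left_mono mult_right_mono) auto
    finally have "U n \<le> (8 * real (m + 1) + 5) * \<epsilon> * (w n * p)" .
    moreover have "0 < w n * p"
    proof (rule mult_pos_pos)
      have "0 < \<beta> ^ k" using \<beta>_pos by simp
      with w[OF n] show "0 < w n" by linarith
    qed (use p in simp)
    moreover have "ratio n \<omega> = U n / (w n * p)"
      unfolding ratio_def U_def p_def by (simp add: sum_subtractf atLeastLessThanSuc_atLeastAtMost)
    ultimately show ?case by (simp add: divide_le_eq)
  qed
qed

text \<open>A positive upper limit exceeds some \<open>1 / (p + 1)\<close>. For each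
  \<open>p\<close>, \<open>\<epsilon>\<close> is scaled so that avoiding the tail of
  \<open>D\<close> would force the limit below this level; countably many null sets are then
  united.\<close>

lemma limsup_ratio_null:
  "V_star M H E {\<omega> \<in> space M. 0 < limsup (\<lambda>n. ereal (ratio n \<omega>))} = 0"
proof -
  define B where "B p = {\<omega> \<in> space M. ereal (1 / real (Suc p)) < limsup (\<lambda>n. ereal (ratio n \<omega>))}" for p
  have "V_star M H E (B p) = 0" for p
  proof -
    define \<epsilon> where "\<epsilon> = 1 / real (Suc p) / (8 * real (m + 1) + 5)"
    have \<epsilon>: "0 < \<epsilon>" "(8 * real (m + 1) + 5) * \<epsilon> = 1 / real (Suc p)"
      by (auto simp: \<epsilon>_def add_pos_pos)
    show ?thesis
    proof (rule Borel_Cantelli[OF D_sets summable_V_D[OF \<epsilon>(1)]], rule subsetI, rule ccontr)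
      fix K \<omega> assume "\<omega> \<in> B p" "\<omega> \<notin> (\<Union>k\<in>{K..}. D \<epsilon> k)"
      with limsup_ratio_le[OF \<epsilon>(1), of \<omega> K] show False
        unfolding \<epsilon>(2) by (auto simp: B_def)
    qed
  qed
  then have "V_star M H E (\<Union>p. B p) = 0" by (rule V_star_null_UN)
  moreover have "V_star M H E {\<omega> \<in> space M. 0 < limsup (\<lambda>n. ereal (ratio n \<omega>))} \<le> V_star M H E (\<Union>p. B p)"
  proof (rule V_star_mono, rule subsetI)
    fix \<omega> assume \<omega>: "\<omega> \<in> {\<omega> \<in> space M. 0 < limsup (\<lambda>n. ereal (ratio n \<omega>))}"
    then obtain z where z: "0 < ereal z" "ereal z < limsup (\<lambda>n. ereal (ratio n \<omega>))"
      using ereal_dense2 by blast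
    then obtain p where "1 / real (Suc p) < z" using nat_approx_posE[of z] by auto
    with z have "ereal (1 / real (Suc p)) < limsup (\<lambda>n. ereal (ratio n \<omega>))"
      by (metis less_ereal.simps(1) less_trans)
    with \<omega> show "\<omega> \<in> (\<Union>p. B p)" by (auto simp: B_def)
  qed
  ultimately show ?thesis by simp
qed

end

section \<open>Invariance of the dependence structure under change of sign\<close>

lemma indep_of_uminus:
  assumes "indep_of E n Y k X"
  shows "indep_of E n (\<lambda>i \<omega>. - Y i \<omega>) k (\<lambda>i \<omega>. - X i \<omega>)"
  unfolding indep_of_def
proof
  fix \<phi> assume \<phi>: "\<phi> \<in> C_b_Lip (k + n)"
  \<comment> \<open>Reflection preserves the seminorm, so the reflected test function stays bounded
    and Lipschitz.\<close>
  define \<psi> where "\<psi> x = \<phi> (\<lambda>i. - x i)" for x :: "nat \<Rightarrow> real"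
  from \<phi> obtain B L where B: "\<And>x. \<bar>\<phi> x\<bar> \<le> B"
    and L: "\<And>x y. \<bar>\<phi> x - \<phi> y\<bar> \<le> L * vnorm (k + n) (\<lambda>i. x i - y i)"
    unfolding C_b_Lip_def by blast
  have vn: "vnorm (k + n) (\<lambda>i. - x i - - y i) = vnorm (k + n) (\<lambda>i. x i - y i)" for x y
    by (simp add: vnorm_def L2_set_def power2_commute)
  have "\<bar>\<psi> x - \<psi> y\<bar> \<le> L * vnorm (k + n) (\<lambda>i. x i - y i)" for x y
    using L[of "\<lambda>i. - x i" "\<lambda>i. - y i"] unfolding \<psi>_def vn .
  moreover have "\<bar>\<psi> x\<bar> \<le> B" for x
    unfolding \<psi>_def by (rule B)
  ultimately have "\<psi> \<in> C_b_Lip (k + n)"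
    unfolding C_b_Lip_def by blast
  moreover have "\<phi> (vappend k (\<lambda>i. - x i) (\<lambda>i. - y i)) = \<psi> (vappend k x y)" for x y
    unfolding \<psi>_def by (rule arg_cong[where f = \<phi>]) (auto simp: vappend_def)
  ultimately show "E (\<lambda>\<omega>. \<phi> (vappend k (\<lambda>i. - X i \<omega>) (\<lambda>i. - Y i \<omega>)))
      = E (\<lambda>\<omega>. E (\<lambda>\<omega>'. \<phi> (vappend k (\<lambda>i. - X i \<omega>) (\<lambda>i. - Y i \<omega>'))))"
    using assms unfolding indep_of_def by simp
qed

lemma blockwise_m_dependent_uminus:
  "blockwise_m_dependent E m N X \<Longrightarrow> blockwise_m_dependent E m N (\<lambda>n \<omega>. - X n \<omega>)"
  unfolding blockwise_m_dependent_def m_dependent_block_def using indep_of_uminus by blast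

theorem theorem4p2:
  fixes M :: "'a measure" and H :: "('a \<Rightarrow> real) set" and E :: "('a \<Rightarrow> real) \<Rightarrow> real"
    and m :: nat and N :: "nat \<Rightarrow> nat" and X :: "nat \<Rightarrow> 'a \<Rightarrow> real"
    and Z :: "'a \<Rightarrow> real" and C r :: real
  assumes space: "sublinear_expectation_space M H E"
    and N_mono: "strict_mono_on {1..} N"
    and X_H: "\<And>n. 1 \<le> n \<Longrightarrow> X n \<in> H"
    and dep: "blockwise_m_dependent E m N X"
    and Z_H: "Z \<in> H"
    and dom: "\<And>(n::nat) t. 1 \<le> n \<Longrightarrow> 0 < t \<Longrightarrow>
        1 / real n * (\<Sum>k=1..n. V_hat M H E {\<omega> \<in> space M. \<bar>X k \<omega>\<bar> > t})
          \<le> C * V_hat M H E {\<omega> \<in> space M. \<bar>Z \<omega>\<bar> > t}"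
    and r: "1 \<le> r" "r < 2"
    and Z_choquet: "choquet M H E (\<lambda>\<omega>. \<bar>Z \<omega>\<bar> powr r) < \<infinity>"
  shows "V_star M H E {\<omega> \<in> space M.
      limsup (\<lambda>n. ereal (((\<Sum>k=1..n. X k \<omega>) - (\<Sum>k=1..n. E_breve E (X k)))
                / (real n powr (1 / r) * real (Phi_blocks N n)))) > 0
    \<or> liminf (\<lambda>n. ereal (((\<Sum>k=1..n. X k \<omega>) - (\<Sum>k=1..n. E_breve_lower E (X k)))
                / (real n powr (1 / r) * real (Phi_blocks N n)))) < 0} = 0"
proof -
  interpret sublinear_expectation_space M H E by (rule space)
  define \<beta> where "\<beta> = 2 powr (1 / r)"
  have \<beta>: "0 < \<beta>" "\<beta> \<le> 2" "2 < \<beta>\<^sup>2"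
  proof -
    show "0 < \<beta>" by (simp add: \<beta>_def)
    have "\<beta> \<le> 2 powr 1" unfolding \<beta>_def using r by (intro powr_mono) auto
    then show "\<beta> \<le> 2" by simp
    \<comment> \<open>Here \<open>2 / r > 1\<close> because \<open>r < 2\<close>.\<close>
    have "2 powr 1 < 2 powr (1 / r + 1 / r)" using r by (intro powr_less_mono) (auto simp: field_simps)
    then show "2 < \<beta>\<^sup>2" unfolding \<beta>_def power2_eq_square powr_add[symmetric] by simp
  qed
  have w: "\<beta> ^ k \<le> real n powr (1 / r)" if "n \<in> dyadic k" for k n
  proof -
    have "\<beta> ^ k = (2 ^ k) powr (1 / r)"
      by (simp add: \<beta>_def powr_realpow[symmetric] powr_powr mult.commute)
    also have "\<dots> \<le> real n powr (1 / r)"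
      using that r by (intro powr_mono2) (auto simp: numeral_power_le_of_nat_cancel_iff)
    finally show ?thesis .
  qed
  \<comment> \<open>\<open>C\<close> may be negative; \<open>\<bar>C\<bar>\<close> meets the sign
    condition of the locale, and the case \<open>n = 0\<close> is an empty sum.\<close>
  have dom': "(\<Sum>k=1..n. V {\<omega> \<in> space M. t < \<bar>X k \<omega>\<bar>}) \<le> \<bar>C\<bar> * real n * V {\<omega> \<in> space M. t < \<bar>Z \<omega>\<bar>}"
    if "0 < t" for n t
  proof (cases "1 \<le> n")
    case True
    have "(\<Sum>k=1..n. V {\<omega> \<in> space M. t < \<bar>X k \<omega>\<bar>}) \<le> C * V {\<omega> \<in> space M. t < \<bar>Z \<omega>\<bar>} * real n"
      using dom[OF True that] True by (simp add: field_simps)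
    also have "\<dots> \<le> \<bar>C\<bar> * V {\<omega> \<in> space M. t < \<bar>Z \<omega>\<bar>} * real n"
      by (intro mult_right_mono V_nonneg) auto
    finally show ?thesis by (simp add: mult_ac)
  qed (simp add: V_nonneg)
  have sZ: "summable (\<lambda>j. 2 ^ j * V {\<omega> \<in> space M. \<beta> ^ j < \<bar>Z \<omega>\<bar>})"
    unfolding \<beta>_def using r by (intro summable_choquet_levels space Z_choquet) simp
  have dom_uminus: "(\<Sum>k=1..n. V {\<omega> \<in> space M. t < \<bar>- X k \<omega>\<bar>}) \<le> \<bar>C\<bar> * real n * V {\<omega> \<in> space M. t < \<bar>Z \<omega>\<bar>}"
    if "0 < t" for n t
    unfolding abs_minus_cancel by (rule dom'[OF that])
  interpret upper: blockwise_dominated_sequence M H E X Z "\<bar>C\<bar>" \<beta> N m "\<lambda>n. real n powr (1 / r)"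
    by unfold_locales (assumption | rule X_H abs_ge_zero dom' \<beta> sZ N_mono dep w)+
  interpret lower: blockwise_dominated_sequence M H E "\<lambda>n \<omega>. - X n \<omega>" Z "\<bar>C\<bar>" \<beta> N m "\<lambda>n. real n powr (1 / r)"
    by unfold_locales (assumption | rule X_H H_uminus abs_ge_zero dom_uminus \<beta> sZ N_mono
      blockwise_m_dependent_uminus[OF dep] w)+
  \<comment> \<open>\<open>E_breve_lower\<close> is minus \<open>E_breve\<close> of
    \<open>- X\<close>, so both the sum and its centring change sign.\<close>
  have neg: "((\<Sum>k=1..n. X k \<omega>) - (\<Sum>k=1..n. E_breve_lower E (X k))) / (real n powr (1 / r) * real (Phi_blocks N n))
      = - lower.ratio n \<omega>" for n \<omega>
    unfolding lower.ratio_def E_breve_lower_def by (simp add: sum_negf minus_divide_left)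
  have "(liminf (\<lambda>n. ereal (- lower.ratio n \<omega>)) < 0) = (0 < limsup (\<lambda>n. ereal (lower.ratio n \<omega>)))" for \<omega>
    using ereal_Liminf_uminus[of sequentially "\<lambda>n. ereal (lower.ratio n \<omega>)"]
    by (simp add: ereal_uminus_less_reorder)
  then have "{\<omega> \<in> space M.
      limsup (\<lambda>n. ereal (((\<Sum>k=1..n. X k \<omega>) - (\<Sum>k=1..n. E_breve E (X k)))
                / (real n powr (1 / r) * real (Phi_blocks N n)))) > 0
    \<or> liminf (\<lambda>n. ereal (((\<Sum>k=1..n. X k \<omega>) - (\<Sum>k=1..n. E_breve_lower E (X k)))
                / (real n powr (1 / r) * real (Phi_blocks N n)))) < 0}
    = {\<omega> \<in> space M. 0 < limsup (\<lambda>n. ereal (upper.ratio n \<omega>))}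
      \<union> {\<omega> \<in> space M. 0 < limsup (\<lambda>n. ereal (lower.ratio n \<omega>))}"
    unfolding neg upper.ratio_def[symmetric] by blast
  then show ?thesis
    using V_star_null_Un[OF upper.limsup_ratio_null lower.limsup_ratio_null] by simp
qed

end
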